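(* Let $A$ be a non-split, non-Lie, nilpotent (left) Leibniz algebra over $\mathbb{C}$ of dimension $6$ with $\dim(A^2)=1$. Then $A$ is isomorphic to a Leibniz algebra with basis $\{x_1,x_2,x_3,x_4,x_5,x_6\}$ whose nonzero products of basis vectors are given by one of the following: (1) $[x_1,x_4]=x_6,\ [x_2,x_5]=x_6,\ [x_4,x_2]=x_6,\ [x_5,x_3]=x_6$. (2) $[x_1,x_5]=x_6,\ [x_2,x_4]=x_6,\ [x_2,x_5]=x_6,\ [x_3,x_3]=x_6,\ [x_3,x_4]=x_6,\ [x_4,x_2]=x_6,\ [x_4,x_3]=-x_6,\ [x_5,x_1]=x_6,\ [x_5,x_2]=-x_6$. (3) $[x_1,x_4]=x_6,\ [x_2,x_3]=x_6,\ [x_2,x_4]=cx_6,\ [x_3,x_2]=cx_6,\ [x_4,x_1]=cx_6,\ [x_4,x_2]=x_6,\ [x_5,x_5]=x_6$, $c\in\mathbb{C}\setminus\{1,-1\}$. (4) $[x_1,x_4]=x_6,\ [x_2,x_3]=x_6,\ [x_2,x_4]=x_6,\ [x_3,x_2]=x_6,\ [x_4,x_1]=x_6,\ [x_4,x_2]=-x_6,\ [x_5,x_5]=x_6$. (5) $[x_1,x_4]=x_6,\ [x_2,x_3]=x_6,\ [x_2,x_4]=x_6,\ [x_3,x_2]=-x_6,\ [x_3,x_3]=x_6,\ [x_4,x_1]=-x_6,\ [x_4,x_2]=x_6,\ [x_5,x_5]=x_6$. (6) $[x_1,x_3]=x_6,\ [x_3,x_2]=x_6,\ [x_4,x_5]=x_6,\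 [x_5,x_4]=-x_6$. (7) $[x_1,x_3]=x_6,\ [x_3,x_2]=x_6,\ [x_4,x_5]=x_6,\ [x_5,x_4]=-x_6,\ [x_5,x_5]=x_6$. (8) $[x_1,x_3]=x_6,\ [x_3,x_2]=x_6,\ [x_4,x_5]=x_6,\ [x_5,x_4]=cx_6$, $c\in\mathbb{C}\setminus\{1,-1\}$. (9) $[x_1,x_3]=x_6,\ [x_2,x_2]=x_6,\ [x_2,x_3]=x_6,\ [x_3,x_1]=x_6,\ [x_3,x_2]=-x_6,\ [x_4,x_5]=x_6,\ [x_5,x_4]=-x_6$. (10) $[x_1,x_3]=x_6,\ [x_2,x_2]=x_6,\ [x_2,x_3]=x_6,\ [x_3,x_1]=x_6,\ [x_3,x_2]=-x_6,\ [x_4,x_5]=x_6,\ [x_5,x_4]=-x_6,\ [x_5,x_5]=x_6$. (11) $[x_1,x_3]=x_6,\ [x_2,x_2]=x_6,\ [x_2,x_3]=x_6,\ [x_3,x_1]=x_6,\ [x_3,x_2]=-x_6,\ [x_4,x_5]=x_6,\ [x_5,x_4]=cx_6$, $c\in\mathbb{C}\setminus\{1,-1\}$. (12) $[x_1,x_3]=x_6,\ [x_3,x_2]=x_6,\ [x_4,x_4]=x_6,\ [x_5,x_5]=x_6$. (13) $[x_1,x_3]=x_6,\ [x_2,x_2]=x_6,\ [x_2,x_3]=x_6,\ [x_3,x_1]=x_6,\ [x_3,x_2]=-x_6,\ [x_4,x_4]=x_6,\ [x_5,x_5]=x_6$. (14) $[x_1,x_2]=x_6,\ [x_2,x_1]=-x_6,\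 [x_3,x_4]=x_6,\ [x_4,x_3]=-x_6,\ [x_5,x_5]=x_6$. (15) $[x_1,x_2]=x_6,\ [x_2,x_1]=-x_6,\ [x_3,x_4]=x_6,\ [x_4,x_3]=-x_6,\ [x_4,x_4]=x_6,\ [x_5,x_5]=x_6$. (16) $[x_1,x_2]=x_6,\ [x_2,x_1]=-x_6,\ [x_3,x_4]=x_6,\ [x_4,x_3]=cx_6,\ [x_5,x_5]=x_6$, $c\in\mathbb{C}\setminus\{1,-1\}$. (17) $[x_1,x_2]=x_6,\ [x_2,x_1]=-x_6,\ [x_2,x_2]=x_6,\ [x_3,x_4]=x_6,\ [x_4,x_3]=-x_6,\ [x_4,x_4]=x_6,\ [x_5,x_5]=x_6$. (18) $[x_1,x_2]=x_6,\ [x_2,x_1]=-x_6,\ [x_2,x_2]=x_6,\ [x_3,x_4]=x_6,\ [x_4,x_3]=cx_6,\ [x_5,x_5]=x_6$, $c\in\mathbb{C}\setminus\{1,-1\}$. (19) $[x_1,x_2]=x_6,\ [x_2,x_1]=c_1x_6,\ [x_3,x_4]=x_6,\ [x_4,x_3]=c_2x_6,\ [x_5,x_5]=x_6$, $c_1,c_2\in\mathbb{C}\setminus\{1,-1\}$. (20) $[x_1,x_2]=x_6,\ [x_2,x_1]=-x_6,\ [x_3,x_3]=x_6,\ [x_4,x_4]=x_6,\ [x_5,x_5]=x_6$. (21) $[x_1,x_2]=x_6,\ [x_2,x_1]=-x_6,\ [x_2,x_2]=x_6,\ [x_3,x_3]=x_6,\ [x_4,x_4]=x_6,\ [x_5,x_5]=x_6$.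 (22) $[x_1,x_2]=x_6,\ [x_2,x_1]=cx_6,\ [x_3,x_3]=x_6,\ [x_4,x_4]=x_6,\ [x_5,x_5]=x_6$, $c\in\mathbb{C}\setminus\{1,-1\}$. (23) $[x_1,x_1]=x_6,\ [x_2,x_2]=x_6,\ [x_3,x_3]=x_6,\ [x_4,x_4]=x_6,\ [x_5,x_5]=x_6$.
   Context: All algebras are over $\mathbb{C}$. A (left) Leibniz algebra is a $\mathbb{C}$-vector space $A$ with a bilinear product $[\,,\,]:A\times A\to A$ such that $[a,[b,c]]=[[a,b],c]+[b,[a,c]]$ for all $a,b,c\in A$. $A$ is a Lie algebra iff $Leib(A)=\mathrm{span}\{[a,a]\mid a\in A\}$ is zero; non-Lie means $Leib(A)\neq 0$. Put $A^1=A$, $A^i=[A,A^{i-1}]$ (span of products) for $i\ge 2$; $A$ is nilpotent if $A^m=0$ for some positive integer $m$. $A$ is split if it is a direct sum of two nontrivial (nonzero) ideals (two-sided), and non-split otherwise. Products of basis vectors not listed are zero (products listed with a coefficient $c$ or $c_i$ are zero when that coefficient is $0$). *)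

theory Defs
  imports "HOL-Analysis.Cartesian_Space"
begin

locale leibniz_algebra = vector_space scale
  for scale :: "complex \<Rightarrow> 'a::ab_group_add \<Rightarrow> 'a" +
  fixes bracket :: "'a \<Rightarrow> 'a \<Rightarrow> 'a"
  assumes linear_left: "\<And>b. Vector_Spaces.linear scale scale (\<lambda>a. bracket a b)"
    and linear_right: "\<And>a. Vector_Spaces.linear scale scale (\<lambda>b. bracket a b)"
    and leibniz: "\<And>a b c. bracket a (bracket b c) = bracket (bracket a b) c + bracket b (bracket a c)"
begin

definition Leib :: "'a set" where
  "Leib = span {bracket a a |a. True}"

text \<open>The series is indexed from 1, as in $A^1 = A$; the value at index 0 is a dummy.\<close>

fun lower_central :: "nat \<Rightarrow> 'a set" where
  "lower_central 0 = UNIV"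
| "lower_central (Suc 0) = UNIV"
| "lower_central (Suc (Suc n)) = span {bracket a b |a b. b \<in> lower_central (Suc n)}"

definition is_nilpotent :: bool where
  "is_nilpotent \<longleftrightarrow> (\<exists>m\<ge>1. lower_central m = {0})"

definition is_ideal :: "'a set \<Rightarrow> bool" where
  "is_ideal I \<longleftrightarrow> subspace I \<and> (\<forall>a. \<forall>x\<in>I. bracket a x \<in> I \<and> bracket x a \<in> I)"

definition is_split :: bool where
  "is_split \<longleftrightarrow> (\<exists>I J. is_ideal I \<and> is_ideal J \<and> I \<noteq> {0} \<and> J \<noteq> {0} \<and>
     I \<inter> J = {0} \<and> {x + y |x y. x \<in> I \<and> y \<in> J} = UNIV)"

definition is_basis6 :: "(nat \<Rightarrow> 'a) \<Rightarrow> bool" where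
  "is_basis6 x \<longleftrightarrow> inj_on x {1..6} \<and> independent (x ` {1..6}) \<and> span (x ` {1..6}) = UNIV"

text \<open>An entry \<open>(i, j, c)\<close> of the table stands for $[x_i,x_j] = c\,x_6$; a pair
  \<open>(i, j)\<close> that is not listed gives the empty sum, i.e.\ $[x_i,x_j] = 0$.\<close>

definition has_products :: "(nat \<Rightarrow> 'a) \<Rightarrow> (nat \<times> nat \<times> complex) list \<Rightarrow> bool" where
  "has_products x tab \<longleftrightarrow> (\<forall>i\<in>{1..6}. \<forall>j\<in>{1..6}.
     bracket (x i) (x j) = scale (\<Sum>(k, l, c)\<leftarrow>tab. if k = i \<and> l = j then c else 0) (x 6))"

end

definition leibniz_isomorphic ::
  "(complex \<Rightarrow> 'a::ab_group_add \<Rightarrow> 'a) \<Rightarrow> ('a \<Rightarrow> 'a \<Rightarrow> 'a) \<Rightarrow>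
   (complex \<Rightarrow> 'b::ab_group_add \<Rightarrow> 'b) \<Rightarrow> ('b \<Rightarrow> 'b \<Rightarrow> 'b) \<Rightarrow> bool" where
  "leibniz_isomorphic s1 br1 s2 br2 \<longleftrightarrow> (\<exists>f. Vector_Spaces.linear s1 s2 f \<and> bij f \<and>
     (\<forall>a b. f (br1 a b) = br2 (f a) (f b)))"

end

(*
  A nilpotent algebra with one-dimensional A^2 = <z> has z central, so the product is
  [a, b] = f(a, b) z for a bilinear form f on A; being non-split means that only the multiples of z
  are orthogonal to A on both sides.  On a complement U of <z> the form f has no common radical, and
  the statement becomes the classification of such forms on a 5-dimensional space up to congruence:
  five vectors with one of the listed Gram matrices are automatically linearly independent.

  Let K be the skew part of f.  A vector of the kernel of K that is not isotropic splits off
  orthogonally.  In odd dimension K has a kernel; an isotropic kernel vector e has a partner y with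
  f(e, y) = f(y, e) = 1, and the remaining freedom is used up by explicit base changes.  In
  dimension 4 with K nondegenerate, an eigenvector of the pencil of the symmetric part against K
  plays the role of e.
*)
theory Submission
  imports
    Defs
    "Jordan_Normal_Form.Char_Poly"
    "HOL-Computational_Algebra.Fundamental_Theorem_Algebra"
begin

section \<open>Bilinear forms and orthogonal decompositions\<close>

text \<open>A vector e serves as a pivot when the functionals B(e, .) and B(., e) are proportional,
  so that orthogonality to e becomes two-sided. For a kernel vector of K they coincide; for x with
  S(x, .) = l K(x, .), where S is the symmetrised form, they are in the ratio (l + 1) : (l - 1). The
  recurring contradiction: once no kernel vector can be split off, all of them are isotropic and
  hence pairwise orthogonal, so no z with B(e, z) = 1 lies in the kernel. Several claims about skew
  products follow by building such a z as a correction of y. The obstacle is that the form need not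
  be invertible: only its two-sided radical is zero, and some normal forms have nonzero one-sided
  radicals, so arguments that invert the Gram matrix do not apply. The 23 tables are Gram matrices
  with row and column 6 omitted: 2 + 6 from which no square is split off, 3 + 6 with one square, 2
  with two, 3 with three, and the identity matrix.\<close>

lemma complex_eigenvector_exists:
  fixes A :: "nat \<Rightarrow> nat \<Rightarrow> complex"
  assumes "n > 0"
  shows "\<exists>l c. (\<exists>i<n. c i \<noteq> 0) \<and> (\<forall>i<n. (\<Sum>j<n. A i j * c j) = l * c i)"
proof -
  define M where "M = mat n n (\<lambda>(i, j). A i j)"
  have M: "M \<in> carrier_mat n n"
    by (simp add: M_def)
  have "degree (char_poly M) = n"
    using degree_monic_char_poly[OF M] by simp
  then have "\<not> constant (poly (char_poly M))"
    using assms by (simp add: constant_degree)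
  then obtain l where "poly (char_poly M) l = 0"
    using fundamental_theorem_of_algebra by blast
  then obtain v where v: "v \<in> carrier_vec n" "v \<noteq> 0\<^sub>v n" "M *\<^sub>v v = l \<cdot>\<^sub>v v"
    using M by (auto simp: eigenvalue_root_char_poly[OF M, symmetric] eigenvalue_def eigenvector_def)
  have "(\<Sum>j<n. A i j * vec_index v j) = l * vec_index v i" if "i < n" for i
  proof -
    have "vec_index (M *\<^sub>v v) i = (\<Sum>j<n. A i j * vec_index v j)"
      using that v(1) by (auto simp: M_def scalar_prod_def lessThan_atLeast0 intro!: sum.cong)
    then show ?thesis
      using that v(1,3) by simp
  qed
  moreover have "\<exists>i<n. vec_index v i \<noteq> 0"
    using v(1,2) by (metis eq_vecI carrier_vecD index_zero_vec)
  ultimately show ?thesis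
    by blast
qed

definition diag_sum :: "complex list list \<Rightarrow> complex list list \<Rightarrow> complex list list" where
  "diag_sum M N = map (\<lambda>r. r @ replicate (length N) 0) M @ map (\<lambda>r. replicate (length M) 0 @ r) N"

locale bilinear_form = finite_dimensional_vector_space scale Basis
  for scale :: "complex \<Rightarrow> 'v::ab_group_add \<Rightarrow> 'v" (infixr "\<cdot>" 75) and Basis +
  fixes B :: "'v \<Rightarrow> 'v \<Rightarrow> complex"
  assumes add_left: "B (x + y) z = B x z + B y z"
    and add_right: "B x (y + z) = B x y + B x z"
    and scale_left: "B (a \<cdot> x) y = a * B x y"
    and scale_right: "B x (a \<cdot> y) = a * B x y"
begin

lemma zero_left [simp]: "B 0 x = 0"
  using scale_left[of 0 0 x] by simp

lemma zero_right [simp]: "B x 0 = 0"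
  using scale_right[of x 0 0] by simp

lemma minus_left: "B (- x) y = - B x y"
  using scale_left[of "-1" x y] by simp

lemma minus_right: "B x (- y) = - B x y"
  using scale_right[of x "-1" y] by simp

lemma diff_left: "B (x - y) z = B x z - B y z"
  using add_left[of x "- y" z] by (simp add: minus_left)

lemma diff_right: "B x (y - z) = B x y - B x z"
  using add_right[of x y "- z"] by (simp add: minus_right)

lemmas bilinear = add_left add_right scale_left scale_right diff_left diff_right minus_left minus_right

section \<open>Gram matrices, orthogonality and the kernel of the skew part\<close>

definition gram :: "'v list \<Rightarrow> complex list list" where
  "gram vs = map (\<lambda>u. map (B u) vs) vs"

definition perp :: "'v set \<Rightarrow> 'v set \<Rightarrow> bool" where
  "perp U W \<longleftrightarrow> (\<forall>u\<in>U. \<forall>w\<in>W. B u w = 0 \<and> B w u = 0)"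

text \<open>No independence is demanded, so a normal form is established by evaluating products
  only; \<open>nonsingular5\<close> recovers independence at the end.\<close>

definition realizes :: "'v set \<Rightarrow> complex list list \<Rightarrow> bool" where
  "realizes U M \<longleftrightarrow> (\<exists>vs. set vs \<subseteq> U \<and> gram vs = M)"

text \<open>These are the vectors in the kernel of the skew part of \<open>B\<close> on
  \<open>U\<close>, not the central elements of an algebra.\<close>

definition central :: "'v set \<Rightarrow> 'v \<Rightarrow> bool" where
  "central U x \<longleftrightarrow> (\<forall>u\<in>U. B x u = B u x)"

text \<open>Only two-sided radical vectors are excluded. One-sided radicals may survive, as the zero
  row and the zero column of the first matrix in \<open>cubic_blocks\<close> show.\<close>

definition nondegenerate :: "'v set \<Rightarrow> bool" where
  "nondegenerate U \<longleftrightarrow> (\<forall>x\<in>U. (\<forall>u\<in>U. B x u = 0 \<and> B u x = 0) \<longrightarrow> x = 0)"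

lemma centralD: "central U x \<Longrightarrow> u \<in> U \<Longrightarrow> B u x = B x u"
  by (simp add: central_def)

lemma realizesI: "set vs \<subseteq> U \<Longrightarrow> gram vs = M \<Longrightarrow> realizes U M"
  by (auto simp: realizes_def)

lemma length_gram [simp]: "length (gram vs) = length vs"
  by (simp add: gram_def)

lemma gram_append:
  assumes "perp (set us) (set vs)"
  shows "gram (us @ vs) = diag_sum (gram us) (gram vs)"
proof -
  have "map (B u) vs = replicate (length vs) 0" if "u \<in> set us" for u
    using assms that by (auto simp: perp_def map_replicate_const[symmetric])
  moreover have "map (B v) us = replicate (length us) 0" if "v \<in> set vs" for v
    using assms that by (auto simp: perp_def map_replicate_const[symmetric])
  ultimately show ?thesis
    by (simp add: gram_def diag_sum_def)
qed

lemma perp_subset: "perp U W \<Longrightarrow> U' \<subseteq> U \<Longrightarrow> W' \<subseteq> W \<Longrightarrow> perp U' W'"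
  unfolding perp_def by blast

lemma realizes_diag_sum:
  assumes "realizes U M" "realizes W N" "perp U W" "U \<subseteq> V" "W \<subseteq> V"
  shows "realizes V (diag_sum M N)"
proof -
  obtain us ws where "set us \<subseteq> U" "gram us = M" "set ws \<subseteq> W" "gram ws = N"
    using assms(1,2) by (auto simp: realizes_def)
  with assms(3-5) show ?thesis
    by (intro realizesI[of "us @ ws"]) (auto simp: gram_append perp_subset)
qed

lemma perp_span:
  assumes "perp X Y"
  shows "perp (span X) (span Y)"
proof -
  have "subspace {u. \<forall>y\<in>Y. B u y = 0 \<and> B y u = 0}"
    by (rule subspaceI) (auto simp: bilinear)
  then have 1: "span X \<subseteq> {u. \<forall>y\<in>Y. B u y = 0 \<and> B y u = 0}"
    using assms by (intro span_minimal) (auto simp: perp_def)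
  have "subspace {y. \<forall>u\<in>span X. B u y = 0 \<and> B y u = 0}"
    by (rule subspaceI) (auto simp: bilinear)
  then have "span Y \<subseteq> {y. \<forall>u\<in>span X. B u y = 0 \<and> B y u = 0}"
    using 1 by (intro span_minimal) auto
  then show ?thesis
    by (auto simp: perp_def)
qed

section \<open>Hyperplanes and complements\<close>

lemma dim_hyperplane:
  fixes \<phi> :: "'v \<Rightarrow> complex"
  assumes U: "subspace U"
    and add: "\<And>x y. \<phi> (x + y) = \<phi> x + \<phi> y" and scale: "\<And>a x. \<phi> (a \<cdot> x) = a * \<phi> x"
    and u: "u \<in> U" "\<phi> u \<noteq> 0"
  shows "subspace {x \<in> U. \<phi> x = 0}" "dim U = Suc (dim {x \<in> U. \<phi> x = 0})"
proof -
  let ?H = "{x \<in> U. \<phi> x = 0}"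
  have zero: "\<phi> 0 = 0"
    using scale[of 0 0] by simp
  show H: "subspace ?H"
    using U by (intro subspaceI) (auto simp: add scale zero subspace_add subspace_scale subspace_0)
  have "x \<in> span (insert u ?H)" if "x \<in> U" for x
  proof -
    define c where "c = - \<phi> x / \<phi> u"
    have "\<phi> x + c * \<phi> u = 0"
      using u by (simp add: c_def)
    then have "\<phi> (x + c \<cdot> u) = 0"
      by (simp only: add scale)
    then have "x + c \<cdot> u \<in> ?H"
      using that u U by (auto intro: subspace_add subspace_scale)
    then have "x + c \<cdot> u \<in> span (insert u ?H)"
      by (meson insertI2 span_base)
    then have "x + c \<cdot> u - c \<cdot> u \<in> span (insert u ?H)"
      by (intro span_diff) (auto intro: span_scale span_base)
    then show ?thesis
      by simp
  qed
  moreover have "span (insert u ?H) \<subseteq> U"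
    using U u by (intro span_minimal) auto
  ultimately have "span (insert u ?H) = U"
    by blast
  moreover have "u \<notin> span ?H"
    using H u by (simp add: span_eq_iff[THEN iffD2, OF H])
  ultimately show "dim U = Suc (dim ?H)"
    by (metis (no_types, lifting) Suc_eq_plus1 dim_insert dim_span)
qed

lemma nonzero_exists:
  assumes "dim U > 0"
  obtains u where "u \<in> U" "u \<noteq> 0"
proof -
  have "\<not> U \<subseteq> {0}"
    using assms by (metis dim_eq_0 less_numeral_extra(3))
  then show thesis
    using that by blast
qed

lemma nonzero_in_hyperplane:
  fixes \<phi> :: "'v \<Rightarrow> complex"
  assumes "subspace U"
    and "\<And>x y. \<phi> (x + y) = \<phi> x + \<phi> y" and "\<And>a x. \<phi> (a \<cdot> x) = a * \<phi> x"
    and "dim U \<ge> 2"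
  obtains u where "u \<in> U" "u \<noteq> 0" "\<phi> u = 0"
proof (cases "\<exists>u\<in>U. \<phi> u \<noteq> 0")
  case True
  then obtain u where "u \<in> U" "\<phi> u \<noteq> 0"
    by blast
  then have "dim U = Suc (dim {x \<in> U. \<phi> x = 0})"
    using dim_hyperplane(2)[of U \<phi> u] assms by blast
  then have "dim {x \<in> U. \<phi> x = 0} > 0"
    using assms(4) by simp
  then show thesis
    using that by (elim nonzero_exists) auto
next
  case False
  then show thesis
    using that assms(4) nonzero_exists[of U] by (metis less_le_trans pos2)
qed

text \<open>The skew part is nondegenerate on the plane of \<open>x\<close> and \<open>y\<close>,
  and \<open>W\<close> is the complement for the skew part alone; symmetric products between
  \<open>W\<close> and the plane remain.\<close>

lemma skew_complement:
  assumes U: "subspace U" and x: "x \<in> U" and y: "y \<in> U" and xy: "B x y \<noteq> B y x"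
  defines "W \<equiv> {w \<in> U. B x w = B w x \<and> B y w = B w y}"
  shows "subspace W" "dim U = dim W + 2" "u \<in> U \<Longrightarrow> \<exists>a b. u - a \<cdot> x - b \<cdot> y \<in> W"
proof -
  let ?V = "{w \<in> U. B x w - B w x = 0}"
  have V: "subspace ?V" "dim U = Suc (dim ?V)"
    using U y xy
    by (intro dim_hyperplane[of U "\<lambda>w. B x w - B w x" y]; simp add: bilinear algebra_simps)+
  have W: "W = {w \<in> ?V. B y w - B w y = 0}"
    by (auto simp: W_def)
  have "subspace W" "dim ?V = Suc (dim W)"
    unfolding W using V x xy
    by (intro dim_hyperplane[of ?V "\<lambda>w. B y w - B w y" x]; simp add: bilinear algebra_simps)+
  then show "subspace W" "dim U = dim W + 2"
    using V by auto
  show "\<exists>a b. u - a \<cdot> x - b \<cdot> y \<in> W" if u: "u \<in> U"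
  proof -
    let ?k = "B x y - B y x"
    have k: "?k \<noteq> 0" "B y x = B x y - ?k"
      using xy by auto
    \<comment> \<open>A vector has zero skew product with itself, so pairing with \<open>y\<close>
      determines \<open>?a\<close> and pairing with \<open>x\<close> determines
      \<open>?b\<close>.\<close>
    let ?a = "- (B y u - B u y) / ?k" and ?b = "(B x u - B u x) / ?k"
    let ?w = "u - ?a \<cdot> x - ?b \<cdot> y"
    have "?w \<in> U"
      using u x y U by (intro subspace_diff subspace_scale)
    moreover have "B x ?w - B ?w x = (B x u - B u x) - ?b * ?k"
      by (simp only: bilinear) (simp only: algebra_simps)
    moreover have "B y ?w - B ?w y = (B y u - B u y) + ?a * ?k"
      by (simp only: bilinear) (simp only: algebra_simps)
    ultimately have "?w \<in> W"
      using k by (simp add: W_def)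
    then show ?thesis
      by blast
  qed
qed

text \<open>An alternating form has even rank: planes are removed two dimensions at a time, and a
  kernel vector of the rest stays one because the rest is skew-orthogonal to the removed
  plane.\<close>

lemma odd_dim_central:
  assumes "subspace U" "odd (dim U)"
  obtains x where "x \<in> U" "x \<noteq> 0" "central U x"
proof -
  have "\<exists>x\<in>U. x \<noteq> 0 \<and> central U x"
    using assms
  proof (induction "dim U" arbitrary: U rule: less_induct)
    case less
    show ?case
    proof (cases "\<forall>x\<in>U. \<forall>y\<in>U. B x y = B y x")
      case True
      have "dim U > 0"
        using less.prems odd_pos by blast
      then show ?thesis
        using True by (metis central_def nonzero_exists)
    next
      case False
      then obtain x y where xy: "x \<in> U" "y \<in> U" "B x y \<noteq> B y x"
        by blast
      let ?W = "{w \<in> U. B x w = B w x \<and> B y w = B w y}"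
      note W = skew_complement[OF less.prems(1) xy]
      obtain z where z: "z \<in> ?W" "z \<noteq> 0" "central ?W z"
        using less.hyps[of ?W] W(1,2) less.prems by auto
      have "B z u = B u z" if u: "u \<in> U" for u
      proof -
        obtain a b where "u - a \<cdot> x - b \<cdot> y \<in> ?W"
          using W(3)[OF u] by blast
        then have "B z (u - a \<cdot> x - b \<cdot> y) = B (u - a \<cdot> x - b \<cdot> y) z"
          using z(3) by (auto simp: central_def)
        moreover have "B x z = B z x" "B y z = B z y"
          using z(1) by auto
        ultimately show ?thesis
          by (simp add: bilinear)
      qed
      then show ?thesis
        using z by (auto simp: central_def)
    qed
  qed
  then show thesis
    using that by blast
qed

text \<open>\<open>e\<close> and \<open>y\<close> form a hyperbolic pair for the symmetric part, and
  the complement is taken for that part only. The difference \<open>B w y - B y w\<close> is left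
  free; the later cases turn on it.\<close>

lemma isotropic_complement:
  assumes U: "subspace U" and nd: "nondegenerate U"
    and e: "e \<in> U" "e \<noteq> 0" "central U e" "B e e = 0"
  obtains y where "y \<in> U" "B e y = 1" "B y e = 1" "B y y = 0"
    "subspace {w \<in> U. B e w = 0 \<and> B y w + B w y = 0}"
    "dim U = dim {w \<in> U. B e w = 0 \<and> B y w + B w y = 0} + 2"
    "\<forall>u\<in>U. \<exists>a b. u - a \<cdot> e - b \<cdot> y \<in> {w \<in> U. B e w = 0 \<and> B y w + B w y = 0}"
proof -
  obtain v where v: "v \<in> U" "B e v \<noteq> 0"
    using nd e centralD[OF e(3)] by (metis nondegenerate_def)
  have ve: "B v e = B e v"
    using v e centralD by blast
  define v' where "v' = (1 / B e v) \<cdot> v"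
  have v': "v' \<in> U" "B e v' = 1" "B v' e = 1"
    using v ve U by (auto simp: v'_def bilinear subspace_scale)
  \<comment> \<open>Both products of \<open>e\<close> with \<open>v'\<close> are 1, so subtracting
    half of \<open>B v' v'\<close> times \<open>e\<close> removes exactly
    \<open>B v' v'\<close>.\<close>
  define y where "y = v' - (B v' v' / 2) \<cdot> e"
  have y: "y \<in> U" "B e y = 1" "B y e = 1" "B y y = 0"
    using v' e U by (auto simp: y_def bilinear subspace_scale subspace_diff)
  let ?V = "{w \<in> U. B e w = 0}" and ?W = "{w \<in> U. B e w = 0 \<and> B y w + B w y = 0}"
  have V: "subspace ?V" "dim U = Suc (dim ?V)"
    using U y by (intro dim_hyperplane[of U "B e" y]; simp add: bilinear)+
  have W: "?W = {w \<in> ?V. B y w + B w y = 0}"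
    by auto
  have W1: "subspace ?W" "dim ?V = Suc (dim ?W)"
    unfolding W using V e y
    by (intro dim_hyperplane[of ?V "\<lambda>w. B y w + B w y" e]; simp add: bilinear algebra_simps)+
  have "\<exists>a b. u - a \<cdot> e - b \<cdot> y \<in> ?W" if u: "u \<in> U" for u
  proof -
    have "u - ((B y u + B u y) / 2) \<cdot> e - B e u \<cdot> y \<in> ?W"
      using u e y U by (auto simp: bilinear subspace_scale subspace_diff)
    then show ?thesis
      by blast
  qed
  then show thesis
    using that[OF y W1(1)] V W1 by simp
qed

text \<open>For a central \<open>x\<close> left and right orthogonality agree, so projecting along
  \<open>x\<close> works as for symmetric forms; a complex square root normalises
  \<open>x\<close>.\<close>

lemma peel_nonisotropic:
  assumes U: "subspace U" and nd: "nondegenerate U"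
    and x: "x \<in> U" "central U x" "B x x \<noteq> 0"
  defines "W \<equiv> {w \<in> U. B x w = 0}"
  shows "subspace W" "dim U = Suc (dim W)" "nondegenerate W"
    "realizes W M \<Longrightarrow> realizes U (diag_sum M [[1]])"
proof -
  show W: "subspace W" "dim U = Suc (dim W)"
    unfolding W_def using U x by (intro dim_hyperplane[of U "B x" x]; simp add: bilinear)+
  have xw: "B x w = 0" "B w x = 0" if "w \<in> W" for w
    using that centralD[OF x(2), of w] by (auto simp: W_def)
  show "nondegenerate W"
    unfolding nondegenerate_def
  proof (intro ballI impI)
    fix w assume w: "w \<in> W" "\<forall>v\<in>W. B w v = 0 \<and> B v w = 0"
    have "B w u = 0 \<and> B u w = 0" if u: "u \<in> U" for u
    proof -
      have "u - (B x u / B x x) \<cdot> x \<in> W"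
        using u x U by (auto simp: W_def bilinear subspace_scale subspace_diff)
      then have "B w (u - (B x u / B x x) \<cdot> x) = 0" "B (u - (B x u / B x x) \<cdot> x) w = 0"
        using w by auto
      then show ?thesis
        using xw[OF w(1)] by (simp add: bilinear)
    qed
    then show "w = 0"
      using nd w by (auto simp: nondegenerate_def W_def)
  qed
  have s: "csqrt (B x x) * csqrt (B x x) = B x x"
    by (metis power2_csqrt power2_eq_square)
  let ?x = "(1 / csqrt (B x x)) \<cdot> x"
  have "B ?x ?x = 1"
    using x s by (simp add: bilinear)
  then have "realizes {?x} [[1]]"
    by (intro realizesI[of "[?x]"]) (auto simp: gram_def)
  moreover have "perp W {?x}"
    using xw by (auto simp: perp_def bilinear)
  moreover have "W \<subseteq> U" "{?x} \<subseteq> U"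
    using x U by (auto simp: W_def subspace_scale)
  ultimately show "realizes U (diag_sum M [[1]])" if "realizes W M"
    using that by (intro realizes_diag_sum)
qed

end

section \<open>Normal forms of explicit tuples\<close>

definition hyperbolic_block :: "complex \<Rightarrow> complex list list" where
  "hyperbolic_block c = [[0, 1], [c, 0]]"

definition tilted_block :: "complex list list" where
  "tilted_block = [[0, 1], [-1, 1]]"

definition hyperbolic_blocks :: "complex list list set" where
  "hyperbolic_blocks = hyperbolic_block ` (- {1, -1})"

text \<open>Representatives of the planar forms that are not symmetric. Parameter 1 would be
  symmetric; -1 is kept apart as the purely skew case, the only one with a tilted variant.\<close>

definition planar_blocks :: "complex list list set" where
  "planar_blocks = {hyperbolic_block (-1), tilted_block} \<union> hyperbolic_blocks"

definition cubic_blocks :: "complex list list set" where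
  "cubic_blocks =
    {[[0, 0, 1], [0, 0, 0], [0, 1, 0]],
     [[0, 0, 1], [0, 1, 1], [1, -1, 0]]}"

text \<open>Two copies of \<open>hyperbolic_block c\<close>, on the vectors 1, 4 and 2, 3, coupled
  through the entries (2, 4) and (4, 2).\<close>

definition quartic_block :: "complex \<Rightarrow> complex list list" where
  "quartic_block c = [[0, 0, 0, 1], [0, 0, 1, c], [0, c, 0, 0], [c, 1, 0, 0]]"

definition quartic_blocks :: "complex list list set" where
  "quartic_blocks =
    {[[0, 0, 0, 1], [0, 0, 1, 1], [0, 1, 0, 0], [1, -1, 0, 0]],
     [[0, 0, 0, 1], [0, 0, 1, 1], [0, -1, 1, 0], [-1, 1, 0, 0]]} \<union> quartic_block ` (- {1, -1})"

definition quintic_blocks :: "complex list list set" where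
  "quintic_blocks =
    {[[0, 0, 0, 1, 0], [0, 0, 0, 0, 1], [0, 0, 0, 0, 0], [0, 1, 0, 0, 0], [0, 0, 1, 0, 0]],
     [[0, 0, 0, 0, 1], [0, 0, 0, 1, 1], [0, 0, 1, 1, 0], [0, 1, -1, 0, 0], [1, -1, 0, 0, 0]]}"

context bilinear_form begin

definition realizes_some :: "'v set \<Rightarrow> complex list list set \<Rightarrow> bool" where
  "realizes_some U \<M> \<longleftrightarrow> (\<exists>M\<in>\<M>. realizes U M)"

lemma realizes_someI: "set vs \<subseteq> U \<Longrightarrow> gram vs \<in> \<M> \<Longrightarrow> realizes_some U \<M>"
  by (auto simp: realizes_some_def realizes_def)

section \<open>Planes with nonzero skew part\<close>

lemma planar_isotropic_pair:
  assumes U: "subspace U" and pq: "p \<in> U" "q \<in> U"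
    and iso: "B p p = 0" "B q q = 0" and ne: "B p q \<noteq> B q p"
  shows "realizes_some U planar_blocks"
proof -
  have *: "realizes_some U planar_blocks"
    if "p \<in> U" "q \<in> U" "B p p = 0" "B q q = 0" "B p q \<noteq> B q p" "B p q \<noteq> 0" for p q
  proof (rule realizes_someI)
    show "set [p, (1 / B p q) \<cdot> q] \<subseteq> U"
      using that U by (auto intro: subspace_scale)
    have "gram [p, (1 / B p q) \<cdot> q] = hyperbolic_block (B q p / B p q)"
      using that by (simp add: gram_def hyperbolic_block_def bilinear)
    moreover have "B q p / B p q \<noteq> 1"
      using that by (simp add: divide_eq_eq)
    ultimately show "gram [p, (1 / B p q) \<cdot> q] \<in> planar_blocks"
      by (auto simp: planar_blocks_def hyperbolic_blocks_def)
  qed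
  \<comment> \<open>The two products differ, so at least one of them is nonzero and can be scaled to
    1.\<close>
  show ?thesis
    using *[of p q] *[of q p] assms by metis
qed

lemma planar_tilted_pair:
  assumes U: "subspace U" and pn: "p \<in> U" "n \<in> U"
    and "B p p = 0" "B n p = - B p n" "B p n \<noteq> 0" "B n n \<noteq> 0"
  shows "realizes_some U planar_blocks"
proof (rule realizes_someI)
  define s where "s = csqrt (B n n)"
  have s: "s * s = B n n" "s \<noteq> 0"
    using assms by (auto simp: s_def power2_eq_square[symmetric])
  let ?vs = "[(s / B p n) \<cdot> p, (1 / s) \<cdot> n]"
  show "set ?vs \<subseteq> U"
    using pn U by (auto intro: subspace_scale)
  have "gram ?vs = tilted_block"
    using assms s by (simp add: gram_def tilted_block_def bilinear)
  then show "gram ?vs \<in> planar_blocks"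
    by (auto simp: planar_blocks_def hyperbolic_blocks_def)
qed

text \<open>On the lines of the plane, the quadratic form \<open>B (t u + v) (t u + v)\<close> is a quadratic polynomial
  in \<open>t\<close>; its discriminant decides the type of the block.\<close>

lemma planar_pair:
  assumes U: "subspace U" and uv: "u \<in> U" "v \<in> U" and ne: "B u v \<noteq> B v u"
  shows "realizes_some U planar_blocks"
proof (cases "B u u = 0")
  case True
  define s where "s = B u v + B v u"
  show ?thesis
  proof (cases "s = 0")
    case True
    then have vu: "B v u = - B u v"
      by (simp add: s_def eq_neg_iff_add_eq_0 add.commute)
    then have "B u v \<noteq> 0"
      using ne by auto
    then show ?thesis
      using planar_isotropic_pair[OF U uv] planar_tilted_pair[OF U uv] \<open>B u u = 0\<close> ne vu by auto
  next
    case False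
    define q where "q = v - (B v v / s) \<cdot> u"
    have "B q q = B v v - (B v v / s) * s"
      using \<open>B u u = 0\<close> by (simp only: q_def bilinear s_def) (simp add: algebra_simps add_divide_distrib)
    then have "B q q = 0"
      using False by simp
    moreover have "B u q = B u v" "B q u = B v u" "q \<in> U"
      using \<open>B u u = 0\<close> uv U by (auto simp: q_def bilinear subspace_diff subspace_scale)
    ultimately show ?thesis
      using planar_isotropic_pair[OF U uv(1), of q] True ne by auto
  qed
next
  case False
  define s where "s = B u v + B v u"
  define d where "d = csqrt (s\<^sup>2 - 4 * B u u * B v v)"
  have d: "d * d = s * s - 4 * B u u * B v v"
    by (metis d_def power2_csqrt power2_eq_square)
  \<comment> \<open>The factor \<open>2 * B u u\<close> clears denominators:
    \<open>B (p x) (p x)\<close> is \<open>B u u\<close> times \<open>(x + s)^2 - d^2\<close>, so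
    the isotropic lines are at \<open>x = - s + d\<close> and \<open>x = - s - d\<close>.\<close>
  define p where "p x = x \<cdot> u + (2 * B u u) \<cdot> v" for x
  have p: "p x \<in> U" for x
    using uv U by (auto simp: p_def subspace_add subspace_scale)
  have pp: "B (p x) (p x) = B u u * (x * x + 2 * x * s + 4 * B u u * B v v)" for x
    by (simp add: p_def bilinear s_def algebra_simps)
  show ?thesis
  proof (cases "d = 0")
    case True
    have 1: "B (p (- s)) (p (- s)) = 0"
      using d True by (simp add: pp algebra_simps)
    \<comment> \<open>At the double root the isotropic vector is orthogonal to \<open>u\<close> for
      the symmetric part, which is the tilted situation.\<close>
    have 2: "B (p (- s)) u = B u u * (B v u - B u v)" "B u (p (- s)) = - (B u u * (B v u - B u v))"
      by (simp_all add: p_def s_def bilinear algebra_simps)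
    show ?thesis
      using planar_tilted_pair[OF U p uv(1) 1] 2 False ne by auto
  next
    case d0: False
    have iso: "B (p (d - s)) (p (d - s)) = 0" "B (p (- d - s)) (p (- d - s)) = 0"
      using d unfolding pp by (simp_all add: algebra_simps)
    have "B (p (d - s)) (p (- d - s)) - B (p (- d - s)) (p (d - s))
      = 4 * B u u * d * (B u v - B v u)"
      by (simp add: p_def bilinear algebra_simps)
    then have "B (p (d - s)) (p (- d - s)) \<noteq> B (p (- d - s)) (p (d - s))"
      using False d0 ne by auto
    then show ?thesis
      using planar_isotropic_pair[OF U p p iso] by blast
  qed
qed

lemma realizes_some_diag_sum:
  assumes "realizes_some U \<M>" "realizes_some W \<N>" "perp U W" "U \<subseteq> V" "W \<subseteq> V"
  shows "realizes_some V {diag_sum M N |M N. M \<in> \<M> \<and> N \<in> \<N>}"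
proof -
  obtain M N where "M \<in> \<M>" "realizes U M" "N \<in> \<N>" "realizes W N"
    using assms(1,2) by (auto simp: realizes_some_def)
  moreover from this have "realizes V (diag_sum M N)"
    using assms(3-5) realizes_diag_sum by blast
  ultimately show ?thesis
    by (auto simp: realizes_some_def)
qed

section \<open>Tuples around an isotropic kernel vector\<close>

lemma cubic_triple:
  assumes U: "subspace U" and mem: "e \<in> U" "h \<in> U" "y \<in> U"
    and e: "B e e = 0" "B e h = 0" "B h e = 0" "B e y = 1" "B y e = 1"
    and ne: "B h y \<noteq> B y h"
  shows "realizes_some U cubic_blocks"
proof -
  define k where "k = (B h y - B y h) / 2"
  have k: "k \<noteq> 0"
    using ne by (simp add: k_def)
  define g where "g = h - ((B h y + B y h) / 2) \<cdot> e"
  define z where "z = y - (B y y / 2) \<cdot> e"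
  have mem': "g \<in> U" "z \<in> U"
    using mem U by (auto simp: g_def z_def subspace_diff subspace_scale)
  have z: "B e z = 1" "B z e = 1" "B z z = 0" and g: "B e g = 0" "B g e = 0" "B g g = B h h"
    using e by (auto simp: z_def g_def bilinear)
  have gz: "B g z = k" "B z g = - k"
    using e by (auto simp: z_def g_def bilinear k_def field_simps)
  show ?thesis
  proof (cases "B h h = 0")
    case True
    \<comment> \<open>On the span of \<open>e\<close>, \<open>g\<close>, \<open>z\<close> the vector
      \<open>g + k e\<close> lies in the right radical and \<open>g - k e\<close> in the left
      one.\<close>
    let ?vs = "[(1 / (2 * k)) \<cdot> (g + k \<cdot> e), (- 1 / (2 * k)) \<cdot> (g - k \<cdot> e), z]"
    show ?thesis
    proof (rule realizes_someI)
      show "set ?vs \<subseteq> U"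
        using mem mem' U by (auto intro!: subspace_neg subspace_diff subspace_add subspace_scale)
      show "gram ?vs \<in> cubic_blocks"
        using True k e z g gz by (simp add: gram_def cubic_blocks_def bilinear)
    qed
  next
    case False
    define s where "s = csqrt (B h h)"
    have s: "s * s = B h h" "s \<noteq> 0"
      using False by (auto simp: s_def power2_eq_square[symmetric])
    let ?vs = "[(k / s) \<cdot> e, (1 / s) \<cdot> g, (s / k) \<cdot> z]"
    show ?thesis
    proof (rule realizes_someI)
      show "set ?vs \<subseteq> U"
        using mem mem' U by (auto intro!: subspace_neg subspace_diff subspace_add subspace_scale)
      show "gram ?vs \<in> cubic_blocks"
        using s False k e z g gz by (simp add: gram_def cubic_blocks_def bilinear)
    qed
  qed
qed

text \<open>Two corrections decouple \<open>w1\<close>, \<open>w2\<close> from the triple. Adding a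
  combination of them to \<open>y\<close> cancels the skew products; the symmetric remainder is
  removed by multiples of \<open>e\<close>, which change only the products with
  \<open>z\<close>.\<close>

lemma cubic_planar_tuple:
  assumes U: "subspace U" and mem: "e \<in> U" "h \<in> U" "y \<in> U" "w1 \<in> U" "w2 \<in> U"
    and e: "B e e = 0" "B e h = 0" "B h e = 0" "B e y = 1" "B y e = 1"
      "B e w1 = 0" "B w1 e = 0" "B e w2 = 0" "B w2 e = 0"
    and h: "B h w1 = 0" "B w1 h = 0" "B h w2 = 0" "B w2 h = 0"
    and ne: "B h y \<noteq> B y h" "B w1 w2 \<noteq> B w2 w1"
  shows "realizes_some U {diag_sum M N |M N. M \<in> cubic_blocks \<and> N \<in> planar_blocks}"
proof -
  define m where "m = B w1 w2 - B w2 w1"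
  have m: "m \<noteq> 0" "B w1 w2 = B w2 w1 + m"
    using ne by (auto simp: m_def)
  define z where "z = y + ((B w2 y - B y w2) / m) \<cdot> w1 - ((B w1 y - B y w1) / m) \<cdot> w2"
  define v1 where "v1 = w1 - B w1 z \<cdot> e"
  define v2 where "v2 = w2 - B w2 z \<cdot> e"
  have mem': "z \<in> U" "v1 \<in> U" "v2 \<in> U"
    using mem U by (auto simp: v1_def v2_def z_def subspace_diff subspace_add subspace_scale)
  have "B w1 z = B z w1" "B w2 z = B z w2"
    using m(1) by (simp_all add: z_def bilinear m(2) field_simps)
  moreover have z: "B e z = 1" "B z e = 1" "B h z = B h y" "B z h = B y h"
    using e h by (simp_all add: z_def bilinear)
  ultimately have perp: "perp (span {e, h, z}) (span {v1, v2})"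
    using e h by (intro perp_span) (auto simp: perp_def bilinear v1_def v2_def)
  have sub: "span {e, h, z} \<subseteq> U" "span {v1, v2} \<subseteq> U"
    by (intro span_minimal; use mem mem' U in auto)+
  have "realizes_some (span {e, h, z}) cubic_blocks"
    by (rule cubic_triple[of _ e h z]) (use e z ne in \<open>auto intro: span_base\<close>)
  moreover have "B v1 v2 = B w1 w2" "B v2 v1 = B w2 w1"
    using e by (simp_all add: v1_def v2_def bilinear)
  then have "realizes_some (span {v1, v2}) planar_blocks"
    by (intro planar_pair[of _ v1 v2]) (use ne in \<open>auto intro: span_base\<close>)
  ultimately show ?thesis
    using realizes_some_diag_sum[OF _ _ perp sub] by blast
qed

text \<open>Here \<open>h\<close> pairs with \<open>w2\<close>, so the two groups stay linked. The
  corrections of \<open>cubic_planar_tuple\<close> leave only the parameters \<open>k\<close>,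
  \<open>m\<close> and \<open>B w1 w1\<close>; scaling removes them, and whether
  \<open>B w1 w1\<close> is zero decides the block.\<close>

lemma quintic_tuple:
  assumes U: "subspace U" and mem: "e \<in> U" "h \<in> U" "y \<in> U" "w1 \<in> U" "w2 \<in> U"
    and e: "B e e = 0" "B e h = 0" "B h e = 0" "B e y = 1" "B y e = 1"
      "B e w1 = 0" "B w1 e = 0" "B e w2 = 0" "B w2 e = 0"
    and h: "B h h = 0" "B h w1 = 0" "B w1 h = 0" "B h w2 = 1" "B w2 h = 1"
    and w: "B w2 w2 = 0" "B w2 w1 = - B w1 w2" "B w1 w2 \<noteq> 0"
    and ne: "B h y \<noteq> B y h"
  shows "realizes_some U quintic_blocks"
proof -
  define m where "m = B w1 w2"
  have m: "m \<noteq> 0" "B w1 w2 = m" "B w2 w1 = - m"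
    using w by (auto simp: m_def)
  \<comment> \<open>The symmetric product of \<open>w1\<close> and \<open>w2\<close> is zero, so
    their skew product \<open>B w1 w2 - B w2 w1\<close> is \<open>2 * m\<close>.\<close>
  define z0 where "z0 = y + ((B w2 y - B y w2) / (2 * m)) \<cdot> w1 - ((B w1 y - B y w1) / (2 * m)) \<cdot> w2"
  define z where "z = z0 - (B z0 z0 / 2) \<cdot> e"
  define k where "k = (B h y - B y h) / 2"
  have k: "k \<noteq> 0"
    using ne by (simp add: k_def)
  define g where "g = h - ((B h z + B z h) / 2) \<cdot> e"
  define v1 where "v1 = w1 - B w1 z \<cdot> e"
  define v2 where "v2 = w2 - B w2 z \<cdot> e"
  have "z0 \<in> U"
    using mem U by (auto simp: z0_def subspace_diff subspace_add subspace_scale)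
  then have mem': "z \<in> U" "g \<in> U" "v1 \<in> U" "v2 \<in> U"
    using mem U by (auto simp: v1_def v2_def z_def g_def subspace_diff subspace_add subspace_scale)
  have z0: "B w1 z0 = B z0 w1" "B w2 z0 = B z0 w2" "B e z0 = 1" "B z0 e = 1"
     "B h z0 - B z0 h = 2 * k"
    using m e h w by (simp_all add: z0_def bilinear field_simps k_def)
  have z: "B w1 z = B z w1" "B w2 z = B z w2" "B e z = 1" "B z e = 1" "B z z = 0"
     "B h z = B z h + 2 * k"
    using e z0 by (simp_all add: z_def bilinear algebra_simps)
  have gz: "B g z = k" "B z g = - k"
    by (simp_all add: g_def bilinear z(3,4,6) field_simps)
  have fg: "B g g = 0" "B g e = 0" "B e g = 0"
    by (simp_all add: g_def bilinear e h)
  have fe: "B e v1 = 0" "B v1 e = 0" "B e v2 = 0" "B v2 e = 0"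
    by (simp_all add: v1_def v2_def bilinear e h)
  have fz: "B v1 z = 0" "B z v1 = 0" "B v2 z = 0" "B z v2 = 0"
    by (simp_all add: v1_def v2_def bilinear z)
  have fv: "B g v1 = 0" "B v1 g = 0" "B g v2 = 1" "B v2 g = 1"
    by (simp_all add: v1_def v2_def bilinear fg, simp_all add: g_def bilinear e h)
  have f: "B v1 v1 = B w1 w1" "B v1 v2 = m" "B v2 v1 = - m" "B v2 v2 = 0"
    by (simp_all add: v1_def v2_def bilinear e w(1) m)
  note f = f fg fe fz fv gz z(3-5) e(1)
  show ?thesis
  proof (cases "B w1 w1 = 0")
    case True
    \<comment> \<open>Rescaling turns \<open>k\<close> and \<open>m\<close> into 1. Both
      \<open>G\<close>, \<open>v1\<close>, \<open>E\<close> and \<open>W\<close>, \<open>Z\<close>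
      span totally isotropic spaces, so the form is a pencil of two 3 by 2 matrices, and the list
      below puts it into Kronecker form.\<close>
    define G where "G = m \<cdot> g"
    define Z where "Z = (1 / (m * k)) \<cdot> z"
    define E where "E = (m * k) \<cdot> e"
    define W where "W = (1 / m) \<cdot> v2"
    have F: "B G G = 0" "B G E = 0" "B E G = 0" "B G Z = 1" "B Z G = -1" "B G v1 = 0" "B v1 G = 0"
      "B G W = 1" "B W G = 1" "B v1 v1 = 0" "B v1 W = 1" "B W v1 = -1" "B W W = 0"
      "B v1 Z = 0" "B Z v1 = 0" "B W Z = 0" "B Z W = 0" "B E v1 = 0" "B v1 E = 0" "B E W = 0" "B W E = 0"
      "B E Z = 1" "B Z E = 1" "B Z Z = 0" "B E E = 0"
      by (simp_all add: f m(1) k True G_def Z_def E_def W_def bilinear)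
    have MEM: "G \<in> U" "Z \<in> U" "E \<in> U" "W \<in> U"
      using mem mem' U by (auto simp: G_def Z_def E_def W_def subspace_scale)
    \<comment> \<open>the first and the third vector of the list span the right and the left radical\<close>
    let ?vs = "[(1/4) \<cdot> (G + v1 + E), (1/2) \<cdot> (E - v1), (1/4) \<cdot> (v1 + E - G), W + Z, Z - W]"
    show ?thesis
    proof (rule realizes_someI)
      show "set ?vs \<subseteq> U"
        using mem' MEM U by (auto intro!: subspace_neg subspace_diff subspace_add subspace_scale)
      show "gram ?vs \<in> quintic_blocks"
        by (simp add: F gram_def quintic_blocks_def bilinear)
    qed
  next
    case False
    define s where "s = csqrt (B w1 w1)"
    have s: "s * s = B w1 w1" "s \<noteq> 0"
      using False by (auto simp: s_def power2_eq_square[symmetric])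
    let ?vs = "[(k * m / s) \<cdot> e, (m / s) \<cdot> g, (1 / s) \<cdot> v1, (s / m) \<cdot> v2, (s / (k * m)) \<cdot> z]"
    show ?thesis
    proof (rule realizes_someI)
      show "set ?vs \<subseteq> U"
        using mem mem' U by (auto intro!: subspace_neg subspace_diff subspace_add subspace_scale)
      show "gram ?vs \<in> quintic_blocks"
        by (simp add: f s m(1) k gram_def quintic_blocks_def bilinear flip: s(1))
    qed
  qed
qed

end

text \<open>The two blocks are ordered by type, so that every unordered pair of types occurs once.\<close>

definition orthogonal_planes :: "complex list list set" where
  "orthogonal_planes =
    diag_sum (hyperbolic_block (-1)) ` planar_blocks \<union>
    diag_sum tilted_block ` insert tilted_block hyperbolic_blocks \<union>
    {diag_sum M N |M N. M \<in> hyperbolic_blocks \<and> N \<in> hyperbolic_blocks}"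

context bilinear_form begin

lemma realizes_some_Un: "realizes_some U (\<M> \<union> \<N>) \<longleftrightarrow> realizes_some U \<M> \<or> realizes_some U \<N>"
  by (auto simp: realizes_some_def)

section \<open>Two planes in dimension four, orthogonal or coupled\<close>

lemma orthogonal_pairs:
  assumes U: "subspace U" and mem: "x \<in> U" "z \<in> U" "v \<in> U" "w \<in> U"
    and perp: "B x v = 0" "B v x = 0" "B x w = 0" "B w x = 0"
      "B z v = 0" "B v z = 0" "B z w = 0" "B w z = 0"
    and ne: "B x z \<noteq> B z x" "B v w \<noteq> B w v"
  shows "realizes_some U orthogonal_planes"
proof -
  let ?X = "span {x, z}" and ?V = "span {v, w}"
  have perp: "perp ?X ?V" "perp ?V ?X"
    by (rule perp_span; use perp in \<open>auto simp: perp_def\<close>)+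
  have sub: "?X \<subseteq> U" "?V \<subseteq> U"
    by (intro span_minimal; use mem U in auto)+
  have "realizes_some ?X planar_blocks"
    by (rule planar_pair[of _ x z]) (use ne in \<open>auto intro: span_base\<close>)
  then obtain M where M: "M \<in> planar_blocks" "realizes ?X M"
    by (auto simp: realizes_some_def)
  have "realizes_some ?V planar_blocks"
    by (rule planar_pair[of _ v w]) (use ne in \<open>auto intro: span_base\<close>)
  then obtain N where N: "N \<in> planar_blocks" "realizes ?V N"
    by (auto simp: realizes_some_def)
  have "realizes U (diag_sum M N)" "realizes U (diag_sum N M)"
    using M N perp sub realizes_diag_sum by blast+
  moreover have "diag_sum M N \<in> orthogonal_planes \<or> diag_sum N M \<in> orthogonal_planes"
  proof -
    have S: "diag_sum (hyperbolic_block (-1)) P \<in> orthogonal_planes" if "P \<in> planar_blocks" for P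
      using that unfolding orthogonal_planes_def by blast
    have T: "diag_sum tilted_block P \<in> orthogonal_planes"
      if "P = tilted_block \<or> P \<in> hyperbolic_blocks" for P
      using that unfolding orthogonal_planes_def by blast
    have H: "diag_sum P Q \<in> orthogonal_planes"
      if "P \<in> hyperbolic_blocks" "Q \<in> hyperbolic_blocks" for P Q
      using that unfolding orthogonal_planes_def by blast
    have "P = hyperbolic_block (-1) \<or> P = tilted_block \<or> P \<in> hyperbolic_blocks"
      if "P \<in> planar_blocks" for P
      using that unfolding planar_blocks_def by blast
    then show ?thesis
      using S T H M(1) N(1) by metis
  qed
  ultimately show ?thesis
    by (auto simp: realizes_some_def)
qed

text \<open>Both planes carry the same parameter \<open>c\<close>. The coupling \<open>s2\<close> is
  cleared, while \<open>s1\<close> is reshaped by multiples of \<open>x\<close> into products in the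
  ratio \<open>c : 1\<close>; the only divisors are \<open>1 + c\<close> and
  \<open>s1\<close>.\<close>

lemma quartic_ladder:
  assumes U: "subspace U" and mem: "x \<in> U" "z \<in> U" "w1 \<in> U" "w2 \<in> U"
    and x: "B x x = 0" "B x w1 = 0" "B w1 x = 0" "B x w2 = 0" "B w2 x = 0" "B x z = 1" "B z x = c"
    and w: "B w1 w1 = 0" "B w2 w2 = 0" "B w1 w2 = 1" "B w2 w1 = c"
    and s: "B w1 z = s1" "B z w1 = s1" "B w2 z = s2" "B z w2 = s2" "s1 \<noteq> 0"
    and c: "c \<noteq> 1" "c \<noteq> -1"
  shows "realizes_some U quartic_blocks"
proof -
  define d where "d = 1 + c"
  have d: "d \<noteq> 0" "c = d - 1"
    using c by (auto simp: d_def add_eq_0_iff)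
  define z1 where "z1 = z - (s2 / d) \<cdot> w1"
  define v2 where "v2 = w2 - (s2 / d) \<cdot> x"
  define v1 where "v1 = w1 - (s1 / d) \<cdot> x"
  define z2 where "z2 = z1 - (B z1 z1 / d) \<cdot> x"
  have z1: "B x z1 = 1" "B z1 x = c" "B w1 z1 = s1" "B z1 w1 = s1"
    "B w2 z1 = s2 - s2 * c / d" "B z1 w2 = s2 - s2 / d"
    by (simp_all add: z1_def bilinear x w s)
  have vz: "B v1 z1 = c * s1 / d" "B z1 v1 = s1 / d" "B v2 z1 = 0" "B z1 v2 = 0"
    using d by (simp_all add: v1_def v2_def bilinear z1 d(2) field_simps)
  have v: "B v1 v1 = 0" "B v2 v2 = 0" "B v1 v2 = 1" "B v2 v1 = c"
      "B x v1 = 0" "B v1 x = 0" "B x v2 = 0" "B v2 x = 0"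
    by (simp_all add: v1_def v2_def bilinear x w)
  have z2: "B x z2 = 1" "B z2 x = c" "B v1 z2 = c * s1 / d" "B z2 v1 = s1 / d" "B v2 z2 = 0" "B z2 v2 = 0"
    by (simp_all add: z2_def bilinear z1 vz v x)
  have zz: "B z2 z2 = 0"
    using d(1) by (simp add: z2_def bilinear z1 x d(2) field_simps)
  have mem': "z2 \<in> U" "v1 \<in> U" "v2 \<in> U"
    using mem U by (auto simp: z2_def z1_def v1_def v2_def subspace_diff subspace_scale)
  let ?vs = "[(s1 / d) \<cdot> x, v1, v2, (d / s1) \<cdot> z2]"
  show ?thesis
  proof (rule realizes_someI)
    show "set ?vs \<subseteq> U"
      using mem mem' U by (auto intro: subspace_scale)
    have "gram ?vs = quartic_block c"
      by (simp add: gram_def quartic_block_def bilinear x(1) z2 zz v d(1) s(5))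
    then show "gram ?vs \<in> quartic_blocks"
      using c by (auto simp: quartic_blocks_def)
  qed
qed

text \<open>After the corrections the symmetric part is a hyperbolic plane on \<open>v2\<close>,
  \<open>z1\<close>, and \<open>u\<close>, \<open>x\<close> are dual to these for the skew part.
  Sums and differences diagonalise the symmetric part and separate the planes.\<close>

lemma quartic_skew_case:
  assumes U: "subspace U" and mem: "x \<in> U" "z \<in> U" "w1 \<in> U" "w2 \<in> U"
    and x: "B x x = 0" "B x w1 = 0" "B w1 x = 0" "B x w2 = 0" "B w2 x = 0" "B x z = 1" "B z x = -1"
    and w: "B w1 w1 = 0" "B w2 w2 = 0" "B w1 w2 = 1" "B w2 w1 = -1"
    and s: "B w1 z = s1" "B z w1 = s1" "B w2 z = s2" "B z w2 = s2" "s2 \<noteq> 0"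
  shows "realizes_some U orthogonal_planes"
proof -
  define v2 where "v2 = (1 / s2) \<cdot> w2"
  define v1 where "v1 = s2 \<cdot> w1 - s1 \<cdot> w2"
  define z1 where "z1 = z - (B z z / 2) \<cdot> v2"
  define u where "u = v1 + (B z z / 2) \<cdot> x"
  have v: "B v1 v1 = 0" "B v2 v2 = 0" "B v1 v2 = 1" "B v2 v1 = -1" "B x v1 = 0" "B v1 x = 0" "B x v2 = 0"
     "B v2 x = 0" "B v1 z = 0" "B z v1 = 0" "B v2 z = 1" "B z v2 = 1"
    by (simp_all add: v1_def v2_def bilinear x w s)
  have z1: "B z1 z1 = 0" "B x z1 = 1" "B z1 x = -1" "B v2 z1 = 1" "B z1 v2 = 1"
    "B v1 z1 = - (B z z / 2)" "B z1 v1 = B z z / 2"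
    by (simp_all add: z1_def bilinear x v)
  have u: "B u u = 0" "B u z1 = 0" "B z1 u = 0" "B u v2 = 1" "B v2 u = -1" "B x u = 0" "B u x = 0"
    by (simp_all add: u_def bilinear x v z1)
  have mem': "v2 \<in> U" "z1 \<in> U" "u \<in> U"
    using mem U by (auto simp: v2_def v1_def z1_def u_def subspace_diff subspace_add subspace_scale)
  show ?thesis
    by (rule orthogonal_pairs[of U "x + u" "v2 + z1" "x - u" "v2 - z1"])
      (simp_all add: bilinear u z1 v x mem mem' U subspace_add subspace_diff)
qed

lemma quartic_tilted_case:
  assumes U: "subspace U" and mem: "x \<in> U" "z \<in> U" "w1 \<in> U" "w2 \<in> U"
    and x: "B x x = 0" "B x w1 = 0" "B w1 x = 0" "B x w2 = 0" "B w2 x = 0" "B x z = 1" "B z x = -1"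
    and w: "B w1 w1 = 0" "B w2 w2 = 1" "B w1 w2 = 1" "B w2 w1 = -1"
    and s: "B w1 z = s1" "B z w1 = s1" "B w2 z = s2" "B z w2 = s2" "s1 \<noteq> 0"
  shows "realizes_some U quartic_blocks"
proof -
  define v1 where "v1 = w1 + s2 \<cdot> x"
  define z1 where "z1 = z - s2 \<cdot> w2"
  \<comment> \<open>The value making \<open>z2\<close> isotropic; the same multiple of
    \<open>x\<close> in \<open>v2\<close> keeps \<open>v2\<close> and \<open>z2\<close>
    orthogonal.\<close>
  define a where "a = - B z1 z1 / (2 * s1)"
  define v2 where "v2 = w2 + a \<cdot> x"
  define z2 where "z2 = z1 + a \<cdot> v1"
  have v1: "B v1 v1 = 0" "B w2 v1 = -1" "B v1 w2 = 1" "B x v1 = 0" "B v1 x = 0"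
    by (simp_all add: v1_def bilinear x w)
  have z1: "B v1 z1 = s1" "B z1 v1 = s1" "B w2 z1 = 0" "B z1 w2 = 0" "B x z1 = 1" "B z1 x = -1"
    by (simp_all add: z1_def v1_def bilinear x w s)
  have v2: "B v1 v2 = 1" "B v2 v1 = -1" "B v2 v2 = 1" "B x v2 = 0" "B v2 x = 0" "B v2 z1 = a" "B z1 v2 = - a"
    by (simp_all add: v2_def bilinear x w v1 z1)
  have z2: "B v1 z2 = s1" "B z2 v1 = s1" "B v2 z2 = 0" "B z2 v2 = 0" "B x z2 = 1" "B z2 x = -1"
    by (simp_all add: z2_def bilinear x v1 v2 z1)
  have zz: "B z2 z2 = 0"
    using s(5) by (simp add: z2_def bilinear v1 z1 a_def)
  have mem': "v1 \<in> U" "v2 \<in> U" "z2 \<in> U"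
    using mem U by (auto simp: v2_def v1_def z1_def z2_def subspace_diff subspace_add subspace_scale)
  let ?vs = "[s1 \<cdot> x, v1, v2, (1 / s1) \<cdot> z2]"
  show ?thesis
  proof (rule realizes_someI)
    show "set ?vs \<subseteq> U"
      using mem mem' U by (auto intro: subspace_scale)
    show "gram ?vs \<in> quartic_blocks"
      by (simp add: gram_def quartic_blocks_def bilinear x(1) z2 zz v1 v2 s(5))
  qed
qed

text \<open>The ladder with parameter 0 and the ratio of \<open>x\<close>, \<open>z\<close>
  reversed, which cannot be reduced to \<open>quartic_ladder\<close> by passing to
  \<open>1 / c\<close>.\<close>

lemma quartic_nilpotent_case:
  assumes U: "subspace U" and mem: "x \<in> U" "z \<in> U" "w1 \<in> U" "w2 \<in> U"
    and x: "B x x = 0" "B x w1 = 0" "B w1 x = 0" "B x w2 = 0" "B w2 x = 0" "B x z = 0" "B z x = 1"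
    and w: "B w1 w1 = 0" "B w2 w2 = 0" "B w1 w2 = 1" "B w2 w1 = 0"
    and s: "B w1 z = s1" "B z w1 = s1" "B w2 z = s2" "B z w2 = s2" "s2 \<noteq> 0"
  shows "realizes_some U quartic_blocks"
proof -
  define z1 where "z1 = z - s1 \<cdot> w2"
  define v1 where "v1 = w1 - s1 \<cdot> x"
  define v2 where "v2 = w2 - s2 \<cdot> x"
  define z2 where "z2 = z1 - B z1 z1 \<cdot> x"
  have z1: "B x z1 = 0" "B z1 x = 1" "B w1 z1 = 0" "B z1 w1 = s1" "B w2 z1 = s2" "B z1 w2 = s2"
    by (simp_all add: z1_def bilinear x w s)
  have v: "B v1 v1 = 0" "B v2 v2 = 0" "B v1 v2 = 1" "B v2 v1 = 0" "B x v1 = 0" "B v1 x = 0" "B x v2 = 0"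
     "B v2 x = 0" "B v1 z1 = 0" "B z1 v1 = 0" "B v2 z1 = s2" "B z1 v2 = 0"
    by (simp_all add: v1_def v2_def bilinear x w z1)
  have z2: "B z2 z2 = 0" "B x z2 = 0" "B z2 x = 1" "B v1 z2 = 0" "B z2 v1 = 0" "B v2 z2 = s2" "B z2 v2 = 0"
    by (simp_all add: z2_def bilinear x v z1)
  have mem': "v1 \<in> U" "v2 \<in> U" "z2 \<in> U"
    using mem U by (auto simp: v2_def v1_def z1_def z2_def subspace_diff subspace_add subspace_scale)
  let ?vs = "[v1, (1 / s2) \<cdot> z2, s2 \<cdot> x, v2]"
  show ?thesis
  proof (rule realizes_someI)
    show "set ?vs \<subseteq> U"
      using mem mem' U by (auto intro: subspace_scale)
    have "gram ?vs = quartic_block 0"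
      by (simp add: gram_def quartic_block_def bilinear x(1) z2 v s(5))
    then show "gram ?vs \<in> quartic_blocks"
      by (auto simp: quartic_blocks_def)
  qed
qed

text \<open>Replacing \<open>z\<close> by \<open>z + b1 w1 + b2 w2\<close> spoils the
  skew-orthogonality of \<open>w1\<close>, \<open>w2\<close> to it; multiples of \<open>x\<close>
  repair this. The two equations for \<open>b1\<close>, \<open>b2\<close> say that no symmetric
  coupling remains. Their matrix is singular exactly when \<open>l\<close> is an eigenvalue of the
  pencil on the plane of \<open>w1\<close>, \<open>w2\<close>.\<close>

lemma quartic_split:
  assumes U: "subspace U" and mem: "x \<in> U" "z \<in> U" "w1 \<in> U" "w2 \<in> U"
    and x: "B x x = 0" "B x w1 = 0" "B w1 x = 0" "B x w2 = 0" "B w2 x = 0"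
      "B x z = l + 1" "B z x = l - 1"
    and ne: "B w1 w2 \<noteq> B w2 w1"
    and s: "B w1 z = s1" "B z w1 = s1" "B w2 z = s2" "B z w2 = s2"
    and b1: "s1 + b1 * B w1 w1 + b2 * ((B w1 w2 + B w2 w1) / 2 - l * (B w1 w2 - B w2 w1) / 2) = 0"
    and b2: "s2 + b1 * ((B w1 w2 + B w2 w1) / 2 + l * (B w1 w2 - B w2 w1) / 2) + b2 * B w2 w2 = 0"
  shows "realizes_some U orthogonal_planes"
proof -
  define m where "m = (B w1 w2 - B w2 w1) / 2"
  define t where "t = (B w1 w2 + B w2 w1) / 2"
  have w: "B w1 w2 = t + m" "B w2 w1 = t - m"
    by (simp_all add: m_def t_def field_simps)
  have b: "s1 + b1 * B w1 w1 + b2 * (t - l * m) = 0" "s2 + b1 * (t + l * m) + b2 * B w2 w2 = 0"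
    using b1 b2 by (simp_all add: m_def t_def)
  define v1 where "v1 = w1 - (b2 * m) \<cdot> x"
  define v2 where "v2 = w2 + (b1 * m) \<cdot> x"
  define z1 where "z1 = z + b1 \<cdot> w1 + b2 \<cdot> w2"
  have "B v1 z1 = s1 + b1 * B w1 w1 + b2 * (t - l * m)" "B z1 v1 = s1 + b1 * B w1 w1 + b2 * (t - l * m)"
    "B v2 z1 = s2 + b1 * (t + l * m) + b2 * B w2 w2" "B z1 v2 = s2 + b1 * (t + l * m) + b2 * B w2 w2"
    by (simp_all add: v1_def v2_def z1_def bilinear x s w algebra_simps)
  moreover have "B v1 v2 = B w1 w2" "B v2 v1 = B w2 w1" "B x v1 = 0" "B v1 x = 0" "B x v2 = 0" "B v2 x = 0"
    "B x z1 = l + 1" "B z1 x = l - 1"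
    by (simp_all add: v1_def v2_def z1_def bilinear x)
  moreover have "v1 \<in> U" "v2 \<in> U" "z1 \<in> U"
    using mem U by (auto simp: v2_def v1_def z1_def subspace_diff subspace_add subspace_scale)
  ultimately show ?thesis
    using b ne by (intro orthogonal_pairs[of U x z1 v1 v2]) (simp_all add: U mem)
qed

lemma quartic_hyperbolic_case:
  assumes U: "subspace U" and mem: "x \<in> U" "z \<in> U" "w1 \<in> U" "w2 \<in> U"
    and x: "B x x = 0" "B x w1 = 0" "B w1 x = 0" "B x w2 = 0" "B w2 x = 0"
      "B x z = l + 1" "B z x = l - 1"
    and w: "B w1 w1 = 0" "B w2 w2 = 0" "B w1 w2 = 1" "B w2 w1 = c" "c \<noteq> 1" "c \<noteq> -1"
    and s: "B w1 z = s1" "B z w1 = s1" "B w2 z = s2" "B z w2 = s2"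
  shows "realizes_some U (quartic_blocks \<union> orthogonal_planes)"
proof -
  \<comment> \<open>\<open>P\<close> and \<open>Q\<close> are the coefficients of \<open>b2\<close>
    and \<open>b1\<close> in the system of \<open>quartic_split\<close>, which is antidiagonal for a
    hyperbolic block.\<close>
  define P where "P = (1 + c) / 2 - l * (1 - c) / 2"
  define Q where "Q = (1 + c) / 2 + l * (1 - c) / 2"
  consider "P = 0" "s1 \<noteq> 0" | "Q = 0" "s2 \<noteq> 0" | "P \<noteq> 0 \<or> s1 = 0" "Q \<noteq> 0 \<or> s2 = 0"
    by blast
  then show ?thesis
  proof cases
    case 1
    \<comment> \<open>With \<open>P = 0\<close> this rescaling gives the plane of \<open>x\<close>,
      \<open>z\<close> the parameter \<open>c\<close> of the other plane.\<close>
    define x' where "x' = ((1 - c) / 2) \<cdot> x"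
    have "l * (1 - c) = (1 + c) - 2 * P"
      by (simp add: P_def field_simps)
    then have "l * (1 - c) = 1 + c"
      using 1 by simp
    then have "B x' z = 1" "B z x' = c"
      by (simp_all add: x'_def bilinear x field_simps)
    then have "realizes_some U quartic_blocks"
      using 1 s w mem U
      by (intro quartic_ladder[of U x' z w1 w2 c s1 s2]) (simp_all add: x'_def bilinear x subspace_scale)
    then show ?thesis
      by (simp add: realizes_some_Un)
  next
    case 2
    \<comment> \<open>\<open>Q = 0\<close> yields the reversed ratio \<open>c : 1\<close>.
      Exchanging \<open>w1\<close>, \<open>w2\<close> and dividing by \<open>c\<close> leads to the
      ladder with parameter \<open>1 / c\<close>; \<open>c = 0\<close> is treated apart.\<close>
    define x' where "x' = (- (1 - c) / 2) \<cdot> x"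
    have "l * (1 - c) = 2 * Q - (1 + c)"
      by (simp add: Q_def field_simps)
    then have "l * (1 - c) = - (1 + c)"
      using 2 by simp
    then have xz: "B x' z = c" "B z x' = 1"
      by (simp_all add: x'_def bilinear x field_simps)
    have x': "x' \<in> U" "B x' x' = 0" "B x' w1 = 0" "B w1 x' = 0" "B x' w2 = 0" "B w2 x' = 0"
      using mem U by (simp_all add: x'_def bilinear x subspace_scale)
    have "realizes_some U quartic_blocks"
    proof (cases "c = 0")
      case True
      then show ?thesis
        using 2 s w mem U x' xz by (intro quartic_nilpotent_case[of U x' z w1 w2 s1 s2]) simp_all
    next
      case False
      have "1 / c \<noteq> 1"
        using w(5) by (metis div_by_1 divide_divide_eq_right mult_1)
      moreover have "1 / c \<noteq> - 1"
        using w(6) by (metis div_by_1 divide_divide_eq_right mult_1 minus_divide_right minus_minus)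
      ultimately show ?thesis
        using False 2 mem U
        by (intro quartic_ladder[of U x' "(1 / c) \<cdot> z" w2 "(1 / c) \<cdot> w1" "1 / c" "s2 / c" "s1 / (c * c)"])
          (simp_all add: bilinear x' xz w s subspace_scale)
    qed
    then show ?thesis
      by (simp add: realizes_some_Un)
  next
    case 3
    \<comment> \<open>If \<open>P\<close> or \<open>Q\<close> is zero, so is the corresponding
      \<open>s1\<close> or \<open>s2\<close>, and the convention \<open>0 / 0 = 0\<close> gives a
      valid solution.\<close>
    have "s1 + (- s2 / Q) * B w1 w1 + (- s1 / P) * P = 0" "s2 + (- s2 / Q) * Q + (- s1 / P) * B w2 w2 = 0"
      using 3 w by auto
    then have "realizes_some U orthogonal_planes"
      by (intro quartic_split[OF U mem x _ s, of "- s2 / Q" "- s1 / P"]) (use w in \<open>simp_all add: P_def Q_def\<close>)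
    then show ?thesis
      by (simp add: realizes_some_Un)
  qed
qed

text \<open>The coupling splits off unless \<open>l\<close> is an eigenvalue of the pencil on the
  second plane: only \<open>l = 0\<close> is exceptional for the skew and tilted blocks, and two
  values of \<open>l\<close> for a hyperbolic one.\<close>

lemma quartic_tuple:
  assumes U: "subspace U" and mem: "x \<in> U" "z \<in> U" "w1 \<in> U" "w2 \<in> U"
    and x: "B x x = 0" "B x w1 = 0" "B w1 x = 0" "B x w2 = 0" "B w2 x = 0"
      "B x z = l + 1" "B z x = l - 1"
    and w: "gram [w1, w2] \<in> planar_blocks"
    and s: "B w1 z = B z w1" "B w2 z = B z w2"
  shows "realizes_some U (quartic_blocks \<union> orthogonal_planes)"
proof -
  define s1 where "s1 = B z w1"
  define s2 where "s2 = B z w2"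
  have s: "B w1 z = s1" "B z w1 = s1" "B w2 z = s2" "B z w2 = s2"
    using s by (simp_all add: s1_def s2_def)
  consider
    (skew) "B w1 w1 = 0" "B w1 w2 = 1" "B w2 w1 = -1" "B w2 w2 = 0"
  | (tilted) "B w1 w1 = 0" "B w1 w2 = 1" "B w2 w1 = -1" "B w2 w2 = 1"
  | (hyperbolic) c where "B w1 w1 = 0" "B w1 w2 = 1" "B w2 w1 = c" "B w2 w2 = 0" "c \<noteq> 1" "c \<noteq> -1"
    using w by (auto simp: gram_def planar_blocks_def hyperbolic_blocks_def hyperbolic_block_def tilted_block_def)
  then show ?thesis
  proof cases
    case skew
    have "realizes_some U orthogonal_planes"
    proof (cases "l = 0")
      case False
      then show ?thesis
        by (intro quartic_split[OF U mem x _ s, of "- s2 / l" "s1 / l"]) (simp_all add: skew)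
    next
      case True
      then have xz: "B x z = 1" "B z x = -1"
        using x by simp_all
      consider "s2 \<noteq> 0" | "s1 \<noteq> 0" | "s1 = 0" "s2 = 0"
        by blast
      then show ?thesis
      proof cases
        case 1
        then show ?thesis
          by (intro quartic_skew_case[OF U mem x(1-5) xz _ _ _ _ s]) (simp_all add: skew)
      next
        case 2
        \<comment> \<open>The pair \<open>- w2\<close>, \<open>w1\<close> is again a skew pair, with
          the roles of \<open>s1\<close> and \<open>s2\<close> exchanged up to sign.\<close>
        then show ?thesis
          by (intro quartic_skew_case[of U x z "- w2" w1 "- s2" s1])
            (simp_all add: U mem x(1-5) xz skew s bilinear subspace_neg)
      next
        case 3
        then show ?thesis
          by (intro orthogonal_pairs[of U x z w1 w2]) (simp_all add: U mem x(1-5) xz skew s)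
      qed
    qed
    then show ?thesis
      by (simp add: realizes_some_Un)
  next
    case tilted
    consider "l \<noteq> 0" | "l = 0" "s1 = 0" | "l = 0" "s1 \<noteq> 0"
      by blast
    then show ?thesis
    proof cases
      case 1
      then have "realizes_some U orthogonal_planes"
        by (intro quartic_split[OF U mem x _ s, of "- (s2 + s1 / l) / l" "s1 / l"]) (simp_all add: tilted)
      then show ?thesis
        by (simp add: realizes_some_Un)
    next
      case 2
      then have "realizes_some U orthogonal_planes"
        by (intro quartic_split[OF U mem x _ s, of 0 "- s2"]) (simp_all add: tilted)
      then show ?thesis
        by (simp add: realizes_some_Un)
    next
      case 3
      then have "realizes_some U quartic_blocks"
        by (intro quartic_tilted_case[of U x z w1 w2 s1 s2]) (simp_all add: U mem x tilted s)
      then show ?thesis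
        by (simp add: realizes_some_Un)
    qed
  next
    case hyperbolic
    then show ?thesis
      using quartic_hyperbolic_case[OF U mem x _ _ _ _ _ _ s] by blast
  qed
qed


text \<open>If \<open>x\<close> is central and not isotropic, it splits off; below, all central vectors are
  assumed isotropic, so that by polarization they are pairwise orthogonal.\<close>

lemma central_orthogonal:
  assumes U: "subspace U" and iso: "\<And>x. x \<in> U \<Longrightarrow> central U x \<Longrightarrow> B x x = 0"
    and xy: "x \<in> U" "central U x" "y \<in> U" "central U y"
  shows "B x y = 0"
proof -
  have "central U (x + y)"
    unfolding central_def
  proof
    fix u assume "u \<in> U"
    then show "B (x + y) u = B u (x + y)"
      using centralD[OF xy(2), of u] centralD[OF xy(4), of u] by (simp add: bilinear)
  qed
  then have "B (x + y) (x + y) = 0"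
    using iso U xy by (simp add: subspace_add)
  moreover have "B x x = 0" "B y y = 0" "B y x = B x y"
    using iso xy centralD[OF xy(2), of y] by auto
  ultimately show ?thesis
    by (simp add: bilinear)
qed

lemma dim_1_multiple:
  assumes "subspace W" "dim W = 1" "h \<in> W" "h \<noteq> 0" "w \<in> W"
  obtains c where "w = c \<cdot> h"
proof -
  have "span {h} = W"
    using assms by (intro subspace_dim_equal) (auto simp: span_minimal)
  then show thesis
    using assms(5) that by (auto simp: span_singleton)
qed

text \<open>The given basis is symplectic for the skew part, so the skew products of
  \<open>x\<close> with it are the coordinates of \<open>x\<close> up to sign and order. The rows of
  \<open>A\<close> hold the symmetric products in the matching arrangement: \<open>A\<close> is the
  symmetric part divided by the skew part.\<close>

lemma eigenvector_of_pencil: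
  assumes span: "\<forall>u\<in>U. \<exists>p q r s. u = p \<cdot> a + q \<cdot> b + r \<cdot> a' + s \<cdot> b'"
    and U: "subspace U" and mem: "a \<in> U" "b \<in> U" "a' \<in> U" "b' \<in> U"
    and K: "B a b = B b a + 1" "B a' b' = B b' a' + 1"
      "B a a' = B a' a" "B a b' = B b' a" "B b a' = B a' b" "B b b' = B b' b"
  obtains x l where "x \<in> U" "x \<noteq> 0" "\<forall>u\<in>U. B x u + B u x = l * (B x u - B u x)"
proof -
  define S where "S x y = B x y + B y x" for x y
  define A where "A i j = [[S a b, S b b, S a' b, S b' b], [- S a a, - S b a, - S a' a, - S b' a],
    [S a b', S b b', S a' b', S b' b'], [- S a a', - S b a', - S a' a', - S b' a']] ! i ! j" for i j
  obtain l c where c: "\<exists>i<4. c i \<noteq> 0" and eq: "\<And>i. i < 4 \<Longrightarrow> (\<Sum>j<4. A i j * c j) = l * c i"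
    using complex_eigenvector_exists[of 4 A] by auto
  define x where "x = c 0 \<cdot> a + c 1 \<cdot> b + c 2 \<cdot> a' + c 3 \<cdot> b'"
  have Kx: "B x b - B b x = c 0" "B x a - B a x = - c 1" "B x b' - B b' x = c 2" "B x a' - B a' x = - c 3"
    by (simp_all add: x_def bilinear K algebra_simps)
  have sum4: "(\<Sum>j<4. f j) = f 0 + f 1 + f 2 + f (3::nat)" for f :: "nat \<Rightarrow> complex"
    by (simp add: eval_nat_numeral)
  have Sx: "S x b = l * c 0" "S x a = - l * c 1" "S x b' = l * c 2" "S x a' = - l * c 3"
  proof -
    have "S x b = (\<Sum>j<4. A 0 j * c j)" "S x a = - (\<Sum>j<4. A 1 j * c j)"
      "S x b' = (\<Sum>j<4. A 2 j * c j)" "S x a' = - (\<Sum>j<4. A 3 j * c j)"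
      by (simp_all add: sum4 A_def x_def S_def bilinear algebra_simps)
    then show "S x b = l * c 0" "S x a = - l * c 1" "S x b' = l * c 2" "S x a' = - l * c 3"
      using eq by simp_all
  qed
  have S_K: "S x b = l * (B x b - B b x)" "S x a = l * (B x a - B a x)"
    "S x b' = l * (B x b' - B b' x)" "S x a' = l * (B x a' - B a' x)"
    by (simp_all only: Kx Sx) simp_all
  have "S x u = l * (B x u - B u x)" if u: "u \<in> U" for u
  proof -
    obtain p q r s where u: "u = p \<cdot> a + q \<cdot> b + r \<cdot> a' + s \<cdot> b'"
      using span u by blast
    have "S x u = p * S x a + q * S x b + r * S x a' + s * S x b'"
      by (simp add: u S_def bilinear algebra_simps)
    also have "\<dots> = l * (B x u - B u x)"
      by (simp only: S_K) (simp add: u bilinear algebra_simps)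
    finally show ?thesis .
  qed
  moreover have "x \<noteq> 0"
  proof
    assume "x = 0"
    then have "c 0 = 0" "c 1 = 0" "c 2 = 0" "c 3 = 0"
      using Kx by simp_all
    moreover have "i = 0 \<or> i = 1 \<or> i = 2 \<or> i = 3" if "i < 4" for i :: nat
      using that by auto
    ultimately show False
      using c by metis
  qed
  moreover have "x \<in> U"
    using mem U by (simp add: x_def subspace_add subspace_scale)
  ultimately show thesis
    using that[of x l] by (simp add: S_def)
qed

end

section \<open>Classification up to dimension five\<close>

text \<open>These serve the case that every central vector is isotropic. Dimension 1 is empty: on a
  nondegenerate line all vectors are central and the nonzero ones are not isotropic.\<close>

definition unpeeled_blocks :: "nat \<Rightarrow> complex list list set" where
  "unpeeled_blocks n =
    (if n = 2 then planar_blocks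
     else if n = 3 then cubic_blocks
     else if n = 4 then quartic_blocks \<union> orthogonal_planes
     else if n = 5 then quintic_blocks \<union> {diag_sum M N |M N. M \<in> cubic_blocks \<and> N \<in> planar_blocks}
     else {})"

fun canonical_grams :: "nat \<Rightarrow> complex list list set" where
  "canonical_grams 0 = {[]}"
| "canonical_grams (Suc n) = unpeeled_blocks (Suc n) \<union> (\<lambda>M. diag_sum M [[1]]) ` canonical_grams n"

section \<open>Forms all of whose central vectors are isotropic\<close>

context bilinear_form begin

text \<open>The last conjunct expresses that \<open>y\<close> is not central; phrased with a vector
  of \<open>W\<close>, it supplies the skew product from which the normal forms start.\<close>

definition central_pair :: "'v set \<Rightarrow> 'v \<Rightarrow> 'v \<Rightarrow> 'v set \<Rightarrow> bool" where
  "central_pair U e y W \<longleftrightarrow> y \<in> U \<and> W \<subseteq> U \<and> subspace W \<and> dim U = dim W + 2 \<and>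
    B e e = 0 \<and> B e y = 1 \<and> B y e = 1 \<and> B y y = 0 \<and>
    (\<forall>w\<in>W. B e w = 0 \<and> B w e = 0 \<and> B w y = - B y w) \<and>
    (\<forall>u\<in>U. \<exists>a b. u - a \<cdot> e - b \<cdot> y \<in> W) \<and> (\<exists>w\<in>W. B w y \<noteq> B y w)"

lemma central_pairD:
  assumes "central_pair U e y W"
  shows "y \<in> U" "W \<subseteq> U" "subspace W" "dim U = dim W + 2"
    "B e e = 0" "B e y = 1" "B y e = 1" "B y y = 0"
    "w \<in> W \<Longrightarrow> B e w = 0 \<and> B w e = 0 \<and> B w y = - B y w"
    "u \<in> U \<Longrightarrow> \<exists>a b. u - a \<cdot> e - b \<cdot> y \<in> W"
    "\<exists>w\<in>W. B w y \<noteq> B y w"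
  using assms unfolding central_pair_def by auto

text \<open>If \<open>y\<close> had no skew product with \<open>W\<close>, it would be central, and
  central vectors are pairwise orthogonal by \<open>central_orthogonal\<close>, against
  \<open>B e y = 1\<close>.\<close>

lemma central_pair_exists:
  assumes U: "subspace U" and nd: "nondegenerate U"
    and iso: "\<And>x. x \<in> U \<Longrightarrow> central U x \<Longrightarrow> B x x = 0"
    and e: "e \<in> U" "e \<noteq> 0" "central U e"
  obtains y W where "central_pair U e y W"
proof -
  obtain y where y: "y \<in> U" "B e y = 1" "B y e = 1" "B y y = 0"
    and W: "subspace {w \<in> U. B e w = 0 \<and> B y w + B w y = 0}"
      "dim U = dim {w \<in> U. B e w = 0 \<and> B y w + B w y = 0} + 2"
      "\<forall>u\<in>U. \<exists>a b. u - a \<cdot> e - b \<cdot> y \<in> {w \<in> U. B e w = 0 \<and> B y w + B w y = 0}"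
    by (rule isotropic_complement[OF U nd e iso[OF e(1,3)]])
  define W where "W = {w \<in> U. B e w = 0 \<and> B y w + B w y = 0}"
  have w: "B e w = 0 \<and> B w e = 0 \<and> B w y = - B y w" if "w \<in> W" for w
    using that centralD[OF e(3), of w] by (auto simp: W_def eq_neg_iff_add_eq_0 add.commute)
  have "\<exists>w\<in>W. B w y \<noteq> B y w"
  proof (rule ccontr)
    assume no: "\<not> ?thesis"
    have "central U y"
      unfolding central_def
    proof
      fix u assume "u \<in> U"
      then obtain a b where "u - a \<cdot> e - b \<cdot> y \<in> W"
        using W(3) unfolding W_def by blast
      then have "B (u - a \<cdot> e - b \<cdot> y) y = B y (u - a \<cdot> e - b \<cdot> y)"
        using no by blast
      then show "B y u = B u y"
        by (simp add: bilinear y)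
    qed
    then show False
      using central_orthogonal[OF U iso e(1,3) y(1)] y(2) by simp
  qed
  moreover have "W \<subseteq> U"
    by (auto simp: W_def)
  ultimately have "central_pair U e y W"
    unfolding central_pair_def using y W[folded W_def] iso[OF e(1,3)] w by blast
  then show thesis
    using that by blast
qed

lemma classify_dim_3:
  assumes U: "subspace U" and nd: "nondegenerate U" and dim: "dim U = 3"
    and iso: "\<And>x. x \<in> U \<Longrightarrow> central U x \<Longrightarrow> B x x = 0"
  shows "realizes_some U cubic_blocks"
proof -
  obtain e where e: "e \<in> U" "e \<noteq> 0" "central U e"
    using odd_dim_central[OF U] dim by auto
  obtain y W where "central_pair U e y W"
    by (rule central_pair_exists[OF U nd iso e])
  note yW = central_pairD[OF this]
  obtain h where "h \<in> W" "B h y \<noteq> B y h"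
    using yW(11) by blast
  then show ?thesis
    using yW(1,2,5-9) e U by (intro cubic_triple[of U e h y]) auto
qed

text \<open>On the 3-dimensional \<open>W\<close> the skew part has rank two. Its kernel vector
  \<open>h\<close> there and a skew pair \<open>w1\<close>, \<open>w2\<close> complete
  \<open>e\<close>, \<open>y\<close> to a basis; the products of \<open>h\<close> with itself and
  the pair decide between a cubic plus planar sum and a linked quintic form.\<close>

lemma classify_dim_5:
  assumes U: "subspace U" and nd: "nondegenerate U" and dim: "dim U = 5"
    and iso: "\<And>x. x \<in> U \<Longrightarrow> central U x \<Longrightarrow> B x x = 0"
  shows "realizes_some U (quintic_blocks \<union> {diag_sum M N |M N. M \<in> cubic_blocks \<and> N \<in> planar_blocks})"
proof -
  obtain e where e: "e \<in> U" "e \<noteq> 0" "central U e"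
    using odd_dim_central[OF U] dim by auto
  obtain y W where "central_pair U e y W"
    by (rule central_pair_exists[OF U nd iso e])
  note yW = central_pairD[OF this]
  note y = yW(1) and W = yW(2,3) and dW = yW(4) and ey = yW(5-8) and ew = yW(9) and dec = yW(10)
    and ex = yW(11)
  have dimW: "dim W = 3"
    using dim dW by simp
  \<comment> \<open>If the skew part vanished on \<open>W\<close>, the plane \<open>?W0\<close>
    would consist of central, hence mutually orthogonal vectors; one of them, also orthogonal to
    \<open>w0\<close>, would lie in the radical.\<close>
  have "\<exists>w1\<in>W. \<exists>w2\<in>W. B w1 w2 \<noteq> B w2 w1"
  proof (rule ccontr)
    assume "\<not> ?thesis"
    then have sym: "B w w' = B w' w" if "w \<in> W" "w' \<in> W" for w w'
      using that by blast
    obtain w0 where w0: "w0 \<in> W" "B w0 y \<noteq> B y w0"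
      using ex by blast
    let ?W0 = "{w \<in> W. B w y - B y w = 0}"
    have W0: "subspace ?W0" "dim W = Suc (dim ?W0)"
      using W w0
      by (intro dim_hyperplane[of W "\<lambda>w. B w y - B y w" w0]; simp add: bilinear algebra_simps)+
    obtain p where p: "p \<in> ?W0" "p \<noteq> 0" "B w0 p = 0"
      by (rule nonzero_in_hyperplane[OF W0(1), of "B w0"]) (use W0 dimW in \<open>auto simp: bilinear\<close>)
    have W0_y: "B w y = 0" "B y w = 0" if "w \<in> ?W0" for w
      using that ew[of w] by auto
    have W0_central: "central U w" if w: "w \<in> ?W0" for w
      unfolding central_def
    proof
      fix u assume "u \<in> U"
      then obtain a b where "u - a \<cdot> e - b \<cdot> y \<in> W"
        using dec by blast
      then have "B w (u - a \<cdot> e - b \<cdot> y) = B (u - a \<cdot> e - b \<cdot> y) w"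
        using sym w by blast
      then show "B w u = B u w"
        using W0_y[OF w] ew[of w] w by (simp add: bilinear)
    qed
    have "B p u = 0" if u: "u \<in> U" for u
    proof -
      obtain a b where ab: "u - a \<cdot> e - b \<cdot> y \<in> W" (is "?w \<in> W")
        using dec u by blast
      obtain c where c: "c * (B w0 y - B y w0) = B ?w y - B y ?w"
        using w0(2) by (metis eq_iff_diff_eq_0 nonzero_eq_divide_eq)
      have "?w - c \<cdot> w0 \<in> W"
        using ab w0 W by (simp add: subspace_diff subspace_scale)
      moreover have "B (?w - c \<cdot> w0) y - B y (?w - c \<cdot> w0) = (B ?w y - B y ?w) - c * (B w0 y - B y w0)"
        by (simp only: bilinear) (simp only: algebra_simps)
      ultimately have mem: "?w - c \<cdot> w0 \<in> ?W0"
        using c by simp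
      then have "B p (?w - c \<cdot> w0) = 0"
        using central_orthogonal[OF U iso _ W0_central[OF p(1)] _ W0_central[OF mem]] p W by blast
      moreover have "B p w0 = 0"
        using p(3) sym[OF w0(1), of p] p(1) by simp
      ultimately show ?thesis
        using W0_y[OF p(1)] ew[of p] p(1) by (simp add: bilinear)
    qed
    moreover have "B u p = B p u" if "u \<in> U" for u
      using centralD[OF W0_central[OF p(1)] that] .
    ultimately have "p = 0"
      using nd p(1) W by (auto simp: nondegenerate_def)
    then show False
      using p by simp
  qed
  then obtain w1 w2 where w: "w1 \<in> W" "w2 \<in> W" "B w1 w2 \<noteq> B w2 w1"
    by blast
  obtain h where h: "h \<in> W" "h \<noteq> 0" "central W h"
    using odd_dim_central[OF W(2)] dimW by auto
  note eW = ew[OF h(1)] ew[OF w(1)] ew[OF w(2)]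
  have mem: "h \<in> U" "w1 \<in> U" "w2 \<in> U"
    using h w W by auto
  have hw: "B w1 h = B h w1" "B w2 h = B h w2"
    using centralD[OF h(3)] w by auto
  \<comment> \<open>Otherwise \<open>y\<close>, corrected along \<open>w1\<close> and
    \<open>w2\<close>, would be a central \<open>z\<close> with \<open>B e z = 1\<close>.\<close>
  have hy: "B h y \<noteq> B y h"
  proof
    assume hy: "B h y = B y h"
    define m where "m = B w1 w2 - B w2 w1"
    have m: "m \<noteq> 0" "B w1 w2 = B w2 w1 + m"
      using w by (auto simp: m_def)
    define z where "z = y + ((B w2 y - B y w2) / m) \<cdot> w1 - ((B w1 y - B y w1) / m) \<cdot> w2"
    have zU: "z \<in> U"
      using y mem U by (simp add: z_def subspace_add subspace_diff subspace_scale)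
    have z1: "B z w1 = B w1 z" "B z w2 = B w2 z"
      using m(1) by (simp_all add: z_def bilinear m(2) field_simps)
    have "B h y = 0" "B y h = 0"
      using hy ew[OF h(1)] by auto
    then have z2: "B z e = 1" "B e z = 1" "B z h = B h z"
      by (simp_all add: z_def bilinear ey eW hw)
    have "B z y - B y z = ((B w2 y - B y w2) / m) * (B w1 y - B y w1) - ((B w1 y - B y w1) / m) * (B w2 y - B y w2)"
      by (simp only: z_def bilinear ey)
        (simp add: algebra_simps add_divide_distrib diff_divide_distrib)
    then have z3: "B z y = B y z"
      by simp
    have "central U z"
      unfolding central_def
    proof
      fix u assume "u \<in> U"
      then obtain a b where ab: "u - a \<cdot> e - b \<cdot> y \<in> W" (is "?v \<in> W")
        using dec by blast
      let ?V = "{v \<in> W. B w1 v = B v w1 \<and> B w2 v = B v w2}"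
      note V = skew_complement[OF W(2) w]
      obtain c1 c2 where c: "?v - c1 \<cdot> w1 - c2 \<cdot> w2 \<in> ?V"
        using V(3)[OF ab] by blast
      obtain d where "?v - c1 \<cdot> w1 - c2 \<cdot> w2 = d \<cdot> h"
        by (rule dim_1_multiple[OF V(1) _ _ h(2) c]) (use V(2) dimW h hw in auto)
      then have "u = a \<cdot> e + b \<cdot> y + c1 \<cdot> w1 + c2 \<cdot> w2 + d \<cdot> h"
        by (simp add: algebra_simps)
      then show "B z u = B u z"
        by (simp add: bilinear z1 z2 z3)
    qed
    then show False
      using central_orthogonal[OF U iso e(1,3) zU] z2(2) by simp
  qed
  have hy': "B y h \<noteq> 0"
    using hy ew[OF h(1)] by auto
  define p1 where "p1 = B h w1"
  define p2 where "p2 = B h w2"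
  have p: "B h w1 = p1" "B w1 h = p1" "B h w2 = p2" "B w2 h = p2"
    using hw by (simp_all add: p1_def p2_def)
  \<comment> \<open>\<open>w2\<close> becomes an isotropic partner of \<open>h\<close>;
    \<open>w1\<close> is cleared of its product with \<open>h\<close> and of its symmetric product
    with that partner.\<close>
  have quintic: "realizes_some U quintic_blocks"
    if w: "w1 \<in> W" "w2 \<in> W" "B w1 w2 \<noteq> B w2 w1"
      and p: "B h w1 = p1" "B w1 h = p1" "B h w2 = p2" "B w2 h = p2" "p2 \<noteq> 0" and hh: "B h h = 0"
    for w1 w2 p1 p2
  proof -
    define u2 where "u2 = (1 / p2) \<cdot> w2"
    define v2 where "v2 = u2 - (B u2 u2 / 2) \<cdot> h"
    define u1 where "u1 = w1 - p1 \<cdot> u2"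
    define v1 where "v1 = u1 - ((B u1 v2 + B v2 u1) / 2) \<cdot> h"
    have u: "B h u2 = 1" "B u2 h = 1" "B h u1 = 0" "B u1 h = 0"
      using p by (simp_all add: u1_def u2_def bilinear)
    have v2: "B h v2 = 1" "B v2 h = 1" "B v2 v2 = 0"
      by (simp_all add: v2_def bilinear u hh)
    have v1: "B h v1 = 0" "B v1 h = 0" "B v2 v1 = - B v1 v2"
      by (simp_all add: v1_def bilinear u hh v2 field_simps)
    have "B v1 v2 - B v2 v1 = B u1 u2 - B u2 u1"
      by (simp add: v1_def v2_def bilinear u hh)
    also have "\<dots> = (B w1 w2 - B w2 w1) / p2"
      by (simp add: u1_def u2_def bilinear diff_divide_distrib)
    finally have "B v1 v2 \<noteq> 0"
      using w p(5) v1(3) by auto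
    moreover have v: "v1 \<in> W" "v2 \<in> W"
      using h w W by (simp_all add: v1_def v2_def u1_def u2_def subspace_diff subspace_scale)
    ultimately show ?thesis
      using W by (intro quintic_tuple[of U e h y v1 v2])
        (auto simp: U e(1) y ey eW(1) ew[OF v(1)] ew[OF v(2)] hh v1 v2 hy' mem(1))
  qed
  \<comment> \<open>A nonisotropic \<open>h\<close> can be projected out of \<open>w1\<close>,
    \<open>w2\<close>; if both products vanish, nothing is to be done; otherwise \<open>h\<close>
    has a partner in the pair, which may be taken as the second member.\<close>
  consider "B h h \<noteq> 0" | "p1 = 0" "p2 = 0" | "B h h = 0" "p2 \<noteq> 0" | "B h h = 0" "p1 \<noteq> 0"
    by blast
  then show ?thesis
  proof cases
    case 1
    define v1 where "v1 = w1 - (p1 / B h h) \<cdot> h"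
    define v2 where "v2 = w2 - (p2 / B h h) \<cdot> h"
    have v: "v1 \<in> W" "v2 \<in> W"
      using h w W by (simp_all add: v1_def v2_def subspace_diff subspace_scale)
    have hv: "B h v1 = 0" "B v1 h = 0" "B h v2 = 0" "B v2 h = 0"
      using 1 by (simp_all add: v1_def v2_def bilinear p)
    have "B v1 v2 - B v2 v1 = B w1 w2 - B w2 w1"
      by (simp add: v1_def v2_def bilinear p)
    then have "B v1 v2 \<noteq> B v2 v1"
      using w by auto
    then have "realizes_some U {diag_sum M N |M N. M \<in> cubic_blocks \<and> N \<in> planar_blocks}"
      using W v by (intro cubic_planar_tuple[of U e h y v1 v2])
        (auto simp: U e(1) y ey eW(1) ew[OF v(1)] ew[OF v(2)] hv hy' mem(1))
    then show ?thesis
      by (simp add: realizes_some_Un)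
  next
    case 2
    then have "realizes_some U {diag_sum M N |M N. M \<in> cubic_blocks \<and> N \<in> planar_blocks}"
      using w by (intro cubic_planar_tuple[of U e h y w1 w2]) (auto simp: U e(1) y ey eW p hy' mem)
    then show ?thesis
      by (simp add: realizes_some_Un)
  next
    case 3
    then show ?thesis
      using quintic[OF w p] by (simp add: realizes_some_Un)
  next
    case 4
    then show ?thesis
      using quintic[OF w(2,1) _ p(3,4,1,2)] w(3) by (simp add: realizes_some_Un)
  qed
qed

text \<open>By even rank the kernel of the skew part contains a second vector \<open>h\<close>,
  found in \<open>W\<close> as one without product with \<open>y\<close>. The pairs
  \<open>e\<close>, \<open>y\<close> and \<open>h\<close>, \<open>g\<close> are linked by the skew
  product of \<open>g\<close> and \<open>y\<close>.\<close>

lemma classify_dim_4_degenerate: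
  assumes U: "subspace U" and nd: "nondegenerate U" and dim: "dim U = 4"
    and iso: "\<And>x. x \<in> U \<Longrightarrow> central U x \<Longrightarrow> B x x = 0"
    and e: "e \<in> U" "e \<noteq> 0" "central U e"
  shows "realizes_some U quartic_blocks"
proof -
  obtain y W where "central_pair U e y W"
    by (rule central_pair_exists[OF U nd iso e])
  note yW = central_pairD[OF this]
  note y = yW(1) and W = yW(2,3) and dW = yW(4) and ey = yW(5-8) and ew = yW(9) and dec = yW(10)
    and ex = yW(11)
  have dimW: "dim W = 2"
    using dim dW by simp
  obtain g where g: "g \<in> W" "B g y \<noteq> B y g"
    using ex by blast
  let ?W0 = "{w \<in> W. B w y - B y w = 0}"
  have W0: "subspace ?W0" "dim W = Suc (dim ?W0)"
    using W g
    by (intro dim_hyperplane[of W "\<lambda>w. B w y - B y w" g]; simp add: bilinear algebra_simps)+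
  obtain h where h: "h \<in> ?W0" "h \<noteq> 0"
    using nonzero_exists[of ?W0] W0(2) dimW by auto
  have hy: "B h y = 0" "B y h = 0"
    using h ew[of h] by auto
  have span: "\<exists>a b c d. u = a \<cdot> e + b \<cdot> y + c \<cdot> g + d \<cdot> h" if u: "u \<in> U" for u
  proof -
    obtain a b where ab: "u - a \<cdot> e - b \<cdot> y \<in> W" (is "?w \<in> W")
      using dec u by blast
    obtain c where c: "c * (B g y - B y g) = B ?w y - B y ?w"
      using g(2) by (metis eq_iff_diff_eq_0 nonzero_eq_divide_eq)
    have "?w - c \<cdot> g \<in> W"
      using ab g W by (simp add: subspace_diff subspace_scale)
    moreover have "B (?w - c \<cdot> g) y - B y (?w - c \<cdot> g) = (B ?w y - B y ?w) - c * (B g y - B y g)"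
      by (simp only: bilinear) (simp only: algebra_simps)
    ultimately have mem: "?w - c \<cdot> g \<in> ?W0"
      using c by simp
    obtain d where "?w - c \<cdot> g = d \<cdot> h"
      by (rule dim_1_multiple[OF W0(1) _ h mem]) (use W0(2) dimW in auto)
    then have "u = a \<cdot> e + b \<cdot> y + c \<cdot> g + d \<cdot> h"
      by (simp add: algebra_simps)
    then show ?thesis
      by blast
  qed
  have eW: "B e g = 0" "B g e = 0" "B e h = 0" "B h e = 0"
    using ew[OF g(1)] ew[of h] h by auto
  have hU: "h \<in> U" and gU: "g \<in> U"
    using h g W by auto
  \<comment> \<open>Otherwise \<open>y\<close> plus a multiple of \<open>h\<close> would be a
    central vector having product 1 with \<open>e\<close>.\<close>
  have hg: "B h g = B g h"
  proof (rule ccontr)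
    assume hg: "B h g \<noteq> B g h"
    define z where "z = y + ((B g y - B y g) / (B h g - B g h)) \<cdot> h"
    have zU: "z \<in> U"
      using y hU U by (simp add: z_def subspace_add subspace_scale)
    have z: "B e z = 1" "B z e = 1" "B z h = B h z" "B z y = B y z"
      by (simp_all add: z_def bilinear ey eW hy)
    have "B z g - B g z = (B y g - B g y) + (B g y - B y g) / (B h g - B g h) * (B h g - B g h)"
      by (simp only: z_def bilinear) (simp only: algebra_simps)
    then have zg: "B z g = B g z"
      using hg by simp
    have "central U z"
      unfolding central_def
    proof
      fix u assume "u \<in> U"
      then obtain a b c d where "u = a \<cdot> e + b \<cdot> y + c \<cdot> g + d \<cdot> h"
        using span by blast
      then show "B z u = B u z"
        by (simp add: bilinear z zg)
    qed
    then show False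
      using central_orthogonal[OF U iso e(1,3) zU] z(1) by simp
  qed
  have "central U h"
    unfolding central_def
  proof
    fix u assume "u \<in> U"
    then obtain a b c d where "u = a \<cdot> e + b \<cdot> y + c \<cdot> g + d \<cdot> h"
      using span by blast
    then show "B h u = B u h"
      by (simp add: bilinear eW hy hg)
  qed
  then have hh: "B h h = 0"
    using iso hU by blast
  define r where "r = B h g"
  have r: "B h g = r" "B g h = r"
    using hg by (simp_all add: r_def)
  have r0: "r \<noteq> 0"
  proof
    assume "r = 0"
    have "B h u = 0 \<and> B u h = 0" if u: "u \<in> U" for u
    proof -
      obtain a b c d where "u = a \<cdot> e + b \<cdot> y + c \<cdot> g + d \<cdot> h"
        using span[OF u] by blast
      then show ?thesis
        by (simp add: bilinear eW hy r hh \<open>r = 0\<close>)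
    qed
    then show False
      using nd hU h(2) by (auto simp: nondegenerate_def)
  qed
  define k where "k = B g y"
  have k: "B g y = k" "B y g = - k" "k \<noteq> 0"
    using ew[OF g(1)] g(2) by (auto simp: k_def)
  define v where "v = g - (B g g / (2 * r)) \<cdot> h"
  have v: "B v v = 0" "B h v = r" "B v h = r" "B v y = k" "B y v = - k" "B e v = 0" "B v e = 0"
    using r0 by (simp_all add: v_def bilinear hh r eW hy k(1,2))
  have vU: "v \<in> U"
    using gU hU U by (simp add: v_def subspace_diff subspace_scale)
  let ?vs = "[k \<cdot> e, v, (1 / r) \<cdot> h, (1 / k) \<cdot> y]"
  show ?thesis
  proof (rule realizes_someI)
    show "set ?vs \<subseteq> U"
      using e(1) y hU vU U by (auto intro: subspace_scale)
    show "gram ?vs \<in> quartic_blocks"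
      by (simp add: gram_def quartic_blocks_def bilinear ey eW hy hh v r0 k(3))
  qed
qed

text \<open>The eigenvector \<open>x\<close> and a partner \<open>z\<close> span a plane whose skew
  complement is again a plane, orthogonal to \<open>x\<close> on both sides. All coupling is then
  symmetric and runs through \<open>z\<close>, the situation of
  \<open>quartic_tuple\<close>.\<close>

lemma classify_dim_4_symplectic:
  assumes U: "subspace U" and dim: "dim U = 4"
    and no: "\<And>x. x \<in> U \<Longrightarrow> central U x \<Longrightarrow> x = 0"
  shows "realizes_some U (quartic_blocks \<union> orthogonal_planes)"
proof -
  have skew: "\<exists>v\<in>U. B x v - B v x = c" if x: "x \<in> U" "x \<noteq> 0" for x c
  proof -
    obtain u where u: "u \<in> U" "B x u \<noteq> B u x"
      using no x unfolding central_def by blast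
    have "B x ((c / (B x u - B u x)) \<cdot> u) - B ((c / (B x u - B u x)) \<cdot> u) x
        = c / (B x u - B u x) * (B x u - B u x)"
      by (simp only: bilinear) (simp only: algebra_simps)
    also have "\<dots> = c"
      using u by simp
    finally show ?thesis
      using u U by (meson subspace_scale)
  qed
  have plane: "\<exists>v w. v \<in> W \<and> w \<in> W \<and> B v w - B w v = 1"
    if x: "x \<in> U" "z \<in> U" "B x z \<noteq> B z x" and W: "W = {w \<in> U. B x w = B w x \<and> B z w = B w z}"
    for x z W
  proof -
    note V = skew_complement[OF U x, folded W]
    obtain v where v: "v \<in> W" "v \<noteq> 0"
      using nonzero_exists[of W] V(2) dim by auto
    then obtain u where u: "u \<in> U" "B v u - B u v = 1"
      using skew[of v 1] W by auto
    obtain a b where ab: "u - a \<cdot> x - b \<cdot> z \<in> W"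
      using V(3)[OF u(1)] by blast
    have "B x v = B v x" "B z v = B v z"
      using v W by auto
    then have "B v (u - a \<cdot> x - b \<cdot> z) - B (u - a \<cdot> x - b \<cdot> z) v = 1"
      using u(2) by (simp add: bilinear)
    then show ?thesis
      using v ab by blast
  qed
  obtain a where a: "a \<in> U" "a \<noteq> 0"
    using nonzero_exists[of U] dim by auto
  obtain b where b: "b \<in> U" "B a b - B b a = 1"
    using skew[OF a] by blast
  then have ab: "B a b \<noteq> B b a"
    by auto
  define V where "V = {w \<in> U. B a w = B w a \<and> B b w = B w b}"
  note V = skew_complement[OF U a(1) b(1) ab, folded V_def]
  obtain a' b' where a': "a' \<in> V" "b' \<in> V" "B a' b' - B b' a' = 1"
    using plane[OF a(1) b(1) ab V_def] by blast
  then have a'b': "B a' b' \<noteq> B b' a'"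
    by auto
  let ?V = "{w \<in> V. B a' w = B w a' \<and> B b' w = B w b'}"
  note V' = skew_complement[OF V(1) a'(1,2) a'b']
  have "dim ?V = 0"
    using V(2) V'(2) dim by simp
  then have V0: "?V \<subseteq> {0}"
    by (simp only: dim_eq_0)
  have span: "\<forall>u\<in>U. \<exists>p q r s. u = p \<cdot> a + q \<cdot> b + r \<cdot> a' + s \<cdot> b'"
  proof
    fix u assume u: "u \<in> U"
    obtain p q where pq: "u - p \<cdot> a - q \<cdot> b \<in> V"
      using V(3)[OF u] by blast
    obtain r s where "u - p \<cdot> a - q \<cdot> b - r \<cdot> a' - s \<cdot> b' \<in> ?V"
      using V'(3)[OF pq] by blast
    then have "u - p \<cdot> a - q \<cdot> b - r \<cdot> a' - s \<cdot> b' = 0"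
      using V0 by blast
    then have "u = p \<cdot> a + q \<cdot> b + r \<cdot> a' + s \<cdot> b'"
      by (simp add: algebra_simps)
    then show "\<exists>p q r s. u = p \<cdot> a + q \<cdot> b + r \<cdot> a' + s \<cdot> b'"
      by blast
  qed
  have K: "B a b = B b a + 1" "B a' b' = B b' a' + 1"
      "B a a' = B a' a" "B a b' = B b' a" "B b a' = B a' b" "B b b' = B b' b"
    using b a' by (auto simp: V_def algebra_simps)
  have "a' \<in> U" "b' \<in> U"
    using a' by (auto simp: V_def)
  then obtain x l where x: "x \<in> U" "x \<noteq> 0"
    and xl: "\<forall>u\<in>U. B x u + B u x = l * (B x u - B u x)"
    by (rule eigenvector_of_pencil[OF span U a(1) b(1) _ _ K])
  \<comment> \<open>The value 2 makes \<open>B x z = l + 1\<close> and \<open>B z x = l - 1\<close>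
    free of fractions.\<close>
  obtain z where z: "z \<in> U" "B x z - B z x = 2"
    using skew[OF x(1,2)] by blast
  have xx: "B x x = 0"
    using bspec[OF xl x(1)] by simp
  have sum: "B x z + B z x = 2 * l"
    using bspec[OF xl z(1)] z(2) by simp
  have "2 * (B x z - (l + 1)) = ((B x z + B z x) - 2 * l) + ((B x z - B z x) - 2)"
    "2 * (B z x - (l - 1)) = ((B x z + B z x) - 2 * l) - ((B x z - B z x) - 2)"
    by (simp_all add: algebra_simps)
  then have "2 * (B x z - (l + 1)) = 0" "2 * (B z x - (l - 1)) = 0"
    unfolding sum z(2) by simp_all
  then have xz: "B x z = l + 1" "B z x = l - 1"
    by (simp_all only: mult_eq_0_iff) simp_all
  then have ne: "B x z \<noteq> B z x"
    using z(2) by auto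
  define W where "W = {w \<in> U. B x w = B w x \<and> B z w = B w z}"
  have W: "subspace W"
    using skew_complement(1)[OF U x(1) z(1) ne, folded W_def] .
  obtain v w where vw: "v \<in> W" "w \<in> W" "B v w - B w v = 1"
    using plane[OF x(1) z(1) ne W_def] by blast
  then have "realizes_some W planar_blocks"
    by (intro planar_pair[OF W, of v w]) auto
  then obtain vs where vs: "set vs \<subseteq> W" "gram vs \<in> planar_blocks"
    by (auto simp: realizes_some_def realizes_def)
  have "length vs = 2"
    using vs(2) length_gram[of vs]
    by (auto simp: planar_blocks_def hyperbolic_blocks_def hyperbolic_block_def tilted_block_def simp del: length_gram)
  then obtain w1 w2 where w12: "vs = [w1, w2]"
    by (auto simp: length_Suc_conv eval_nat_numeral)
  \<comment> \<open>On \<open>W\<close> the skew product with \<open>x\<close> is zero, so by the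
    eigenvector equation the symmetric one is too.\<close>
  have xw: "B x w = 0" "B w x = 0" "B w z = B z w" "w \<in> U" if "w \<in> W" for w
    using that bspec[OF xl, of w] by (auto simp: W_def)
  show ?thesis
    using vs unfolding w12
    by (intro quartic_tuple[of U x z w1 w2 l]) (auto simp: U x(1) z(1) xx xz xw)
qed

theorem classification:
  assumes "subspace U" "nondegenerate U" "dim U \<le> 5"
  shows "realizes_some U (canonical_grams (dim U))"
  using assms
proof (induction "dim U" arbitrary: U)
  case 0
  show ?case
    unfolding 0(1)[symmetric] by (rule realizes_someI[of "[]"]) (simp_all add: gram_def)
next
  case (Suc n)
  note U = \<open>subspace U\<close> and nd = \<open>nondegenerate U\<close>
  show ?case
  proof (cases "\<exists>x\<in>U. central U x \<and> B x x \<noteq> 0")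
    case True
    then obtain x where x: "x \<in> U" "central U x" "B x x \<noteq> 0"
      by blast
    let ?W = "{w \<in> U. B x w = 0}"
    note W = peel_nonisotropic[OF U nd x]
    have "realizes_some ?W (canonical_grams n)"
      using Suc.hyps(1)[of ?W] W Suc.hyps(2) Suc.prems(3) by simp
    then show ?thesis
      using W(4) unfolding Suc.hyps(2)[symmetric] by (auto simp: realizes_some_def)
  next
    case False
    then have iso: "B x x = 0" if "x \<in> U" "central U x" for x
      using that by blast
    consider "dim U = 1" | "dim U = 2" | "dim U = 3" | "dim U = 4" | "dim U = 5"
      using Suc.hyps(2) Suc.prems(3) by linarith
    then have "realizes_some U (unpeeled_blocks (dim U))"
    proof cases
      case 1
      then obtain e where e: "e \<in> U" "e \<noteq> 0" "central U e"
        using odd_dim_central[OF U] by auto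
      \<comment> \<open>Impossible on a line, since \<open>central_pair\<close> forces
        \<open>dim U = dim W + 2\<close>.\<close>
      obtain y W where "central_pair U e y W"
        by (rule central_pair_exists[OF U nd iso e])
      then show ?thesis
        using 1 by (simp add: central_pair_def)
    next
      case 2
      \<comment> \<open>A symmetric form would make all vectors central, hence pairwise orthogonal,
        against nondegeneracy.\<close>
      have "\<exists>u\<in>U. \<exists>v\<in>U. B u v \<noteq> B v u"
      proof (rule ccontr)
        assume sym: "\<not> ?thesis"
        then have "central U u" if "u \<in> U" for u
          using that unfolding central_def by blast
        then have "B u v = 0" if "u \<in> U" "v \<in> U" for u v
          using that central_orthogonal[OF U iso] by blast
        then have "U \<subseteq> {0}"
          using nd by (auto simp: nondegenerate_def)
        then show False
          using 2 dim_eq_0[of U] by simp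
      qed
      then show ?thesis
        using 2 planar_pair[OF U] by (auto simp: unpeeled_blocks_def)
    next
      case 3
      then show ?thesis
        using 3 classify_dim_3[OF U nd 3 iso] by (simp add: unpeeled_blocks_def)
    next
      case 4
      show ?thesis
      proof (cases "\<exists>e\<in>U. central U e \<and> e \<noteq> 0")
        case True
        then obtain e where "e \<in> U" "e \<noteq> 0" "central U e"
          by blast
        then have "realizes_some U quartic_blocks"
          by (intro classify_dim_4_degenerate[OF U nd 4 iso])
        then show ?thesis
          using 4 by (simp add: realizes_some_Un unpeeled_blocks_def)
      next
        case False
        then show ?thesis
          using 4 classify_dim_4_symplectic[OF U 4] by (auto simp: unpeeled_blocks_def)
      qed
    next
      case 5
      then show ?thesis
        using 5 classify_dim_5[OF U nd 5 iso] by (simp add: unpeeled_blocks_def)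
    qed
    then show ?thesis
      unfolding Suc.hyps(2)[symmetric] by (simp add: realizes_some_Un)
  qed
qed

end

section \<open>Leibniz algebras\<close>

definition table_gram :: "(nat \<times> nat \<times> complex) list \<Rightarrow> complex list list" where
  "table_gram tab =
    map (\<lambda>i. map (\<lambda>j. \<Sum>(k, l, c)\<leftarrow>tab. if k = i \<and> l = j then c else 0) [1, 2, 3, 4, 5]) [1, 2, 3, 4, 5]"

context leibniz_algebra
begin

section \<open>The derived line and the annihilator of the algebra\<close>

lemma bracket_linear:
  "bracket (a + b) c = bracket a c + bracket b c" "bracket c (a + b) = bracket c a + bracket c b"
  "bracket (scale r a) c = scale r (bracket a c)" "bracket c (scale r a) = scale r (bracket c a)"
  using linear_left[of c] linear_right[of c] by (simp_all add: Vector_Spaces.linear_iff)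

lemma bracket_zero [simp]: "bracket 0 a = 0" "bracket a 0 = 0"
  using bracket_linear(3)[of 0 0 a] bracket_linear(4)[of a 0 0] by simp_all

lemma derived_generator:
  assumes "dim (lower_central 2) = 1"
  obtains z where "z \<noteq> 0" "lower_central 2 = span {z}" "\<forall>a b. bracket a b \<in> span {z}"
proof -
  let ?G = "{bracket a b |a b. b \<in> UNIV}"
  have lc: "lower_central 2 = span ?G"
    by (simp add: eval_nat_numeral)
  obtain X where X: "X \<subseteq> lower_central 2" "independent X" "lower_central 2 \<subseteq> span X" "card X = 1"
    using basis_exists[of "lower_central 2"] assms by metis
  then obtain z where z: "X = {z}"
    by (auto simp: card_1_singleton_iff)
  have "span X \<subseteq> lower_central 2"
    using X(1) unfolding lc by (rule span_minimal) (rule subspace_span)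
  then have eq: "lower_central 2 = span {z}"
    using X(3) z by auto
  moreover have "bracket a b \<in> span {z}" for a b
    unfolding eq[symmetric] lc by (rule span_base) auto
  moreover have "z \<noteq> 0"
    using X(2) z dependent_zero by blast
  ultimately show thesis
    using that by blast
qed

text \<open>The series is built by left multiplication, so nilpotency controls
  \<open>bracket a z\<close>: were it a nonzero multiple of \<open>z\<close>, then \<open>z\<close>
  would lie in every term. For the other side, the Leibniz identity writes
  \<open>[[x, y], a]\<close> as \<open>[x, [y, a]] - [y, [x, a]]\<close>, where both inner products
  are multiples of \<open>z\<close>.\<close>

lemma derived_central:
  assumes nil: "is_nilpotent" and z: "z \<noteq> 0" "lower_central 2 = span {z}" "\<forall>a b. bracket a b \<in> span {z}"
  shows "bracket a z = 0" "bracket z a = 0"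
proof -
  have right: "bracket a z = 0" for a
  proof (rule ccontr)
    assume nz: "bracket a z \<noteq> 0"
    have "bracket a z \<in> span {z}"
      using z(3) by blast
    then obtain m where m: "bracket a z = scale m z"
      unfolding span_singleton by auto
    have "m \<noteq> 0"
      using nz m by auto
    then have z_eq: "z = scale (1 / m) (bracket a z)"
      by (simp add: m)
    have "z \<in> lower_central (Suc n)" for n
    proof (induction n)
      case 0
      then show ?case
        by simp
    next
      case (Suc n)
      then have "bracket a z \<in> lower_central (Suc (Suc n))"
        by (auto intro!: span_base)
      then have "scale (1 / m) (bracket a z) \<in> lower_central (Suc (Suc n))"
        unfolding lower_central.simps by (rule span_scale)
      then show ?case
        using z_eq by simp
    qed
    moreover obtain n where "lower_central (Suc n) = {0}"
      using nil unfolding is_nilpotent_def by (metis One_nat_def Suc_le_D)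
    ultimately show False
      using z(1) by blast
  qed
  have right': "bracket a x = 0" if x: "x \<in> span {z}" for a x
  proof -
    obtain k where "x = scale k z"
      using x unfolding span_singleton by auto
    then show ?thesis
      by (simp add: bracket_linear right)
  qed
  have "bracket (bracket x y) a = 0" for x y
    using leibniz[of x y a] right' z(3) by simp
  moreover have "subspace {x. bracket x a = 0}"
    by (rule subspaceI) (simp_all add: bracket_linear)
  ultimately have "span {bracket x y |x y. y \<in> UNIV} \<subseteq> {x. bracket x a = 0}"
    by (intro span_minimal) auto
  moreover have "z \<in> lower_central 2"
    using z(2) span_base by blast
  ultimately show "bracket z a = 0"
    by (auto simp: eval_nat_numeral)
  show "bracket a z = 0"
    by (rule right)
qed

text \<open>The line of \<open>r\<close> is an ideal since \<open>r\<close> annihilates everything.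
  If \<open>r\<close> is independent of \<open>z\<close>, a complement of it through
  \<open>z\<close> contains all products, so it is an ideal too and the algebra splits.\<close>

lemma center_non_split:
  assumes ns: "\<not> is_split" and z: "z \<noteq> 0" "\<forall>a b. bracket a b \<in> span {z}"
    and r: "\<forall>a. bracket r a = 0 \<and> bracket a r = 0"
  shows "r \<in> span {z}"
proof (rule ccontr)
  assume r': "r \<notin> span {z}"
  have "independent {z}"
    using z(1) by simp
  then have "independent {r, z}"
    using r' by (simp add: independent_insert)
  then obtain X where X: "{r, z} \<subseteq> X" "independent X" "UNIV \<subseteq> span X"
    by (rule maximal_independent_subset_extend[OF subset_UNIV])
  define I where "I = span {r}"
  define J where "J = span (X - {r})"
  have rz: "r \<noteq> z"
    using r' span_base by blast
  then have zJ: "span {z} \<subseteq> J"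
    using X(1) unfolding J_def by (intro span_mono) auto
  have "is_ideal I"
    unfolding is_ideal_def I_def span_singleton
    using r by (auto simp: bracket_linear subspace_span[of "{r}", unfolded span_singleton]
        intro: range_eqI[where x = 0])
  moreover have "is_ideal J"
    unfolding is_ideal_def using zJ z(2) by (auto simp: J_def)
  moreover have "I \<noteq> {0}"
    using r' span_base[of r "{r}"] span_zero unfolding I_def by auto
  moreover have "J \<noteq> {0}"
    using zJ z(1) span_base[of z "{z}"] by auto
  moreover have "I \<inter> J = {0}"
  proof -
    have "x = 0" if x: "x \<in> I" "x \<in> J" for x
    proof (rule ccontr)
      assume "x \<noteq> 0"
      obtain k where k: "x = scale k r"
        using x(1) unfolding I_def span_singleton by auto
      then have "k \<noteq> 0"
        using \<open>x \<noteq> 0\<close> by auto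
      then have "r = scale (1 / k) x"
        by (simp add: k)
      then have "r \<in> J"
        using x(2) span_scale unfolding J_def by blast
      then show False
        using X(1,2) unfolding J_def dependent_def by blast
    qed
    then show ?thesis
      by (auto simp: I_def J_def span_zero)
  qed
  moreover have "{x + y |x y. x \<in> I \<and> y \<in> J} = UNIV"
  proof -
    have "\<exists>x y. a = x + y \<and> x \<in> I \<and> y \<in> J" for a
    proof -
      have "a \<in> span (insert r (X - {r}))"
        using X(1,3) by (auto simp: insert_absorb)
      then obtain k where "a - scale k r \<in> J"
        unfolding span_breakdown_eq J_def by blast
      moreover have "scale k r \<in> I"
        unfolding I_def by (intro span_scale span_base) simp
      moreover have "a = scale k r + (a - scale k r)"
        by simp
      ultimately show ?thesis
        by blast
    qed
    then show ?thesis
      by blast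
  qed
  ultimately show False
    using ns unfolding is_split_def by blast
qed

section \<open>Product tables, bases and coordinates\<close>

lemma has_products_iff_gram:
  assumes f: "\<And>a b. bracket a b = scale (f a b) z" and z: "z \<noteq> 0" "\<And>a. f a z = 0" "\<And>a. f z a = 0"
    and x: "x 1 = v1" "x 2 = v2" "x 3 = v3" "x 4 = v4" "x 5 = v5" "x 6 = z"
    and tab: "\<forall>(k, l, c)\<in>set tab. k < 6 \<and> l < 6"
  shows "has_products x tab \<longleftrightarrow>
    map (\<lambda>u. map (f u) [v1, v2, v3, v4, v5]) [v1, v2, v3, v4, v5] = table_gram tab"
proof -
  define t where "t i j = (\<Sum>(k, l, c)\<leftarrow>tab. if k = i \<and> l = j then c else 0)" for i j
  \<comment> \<open>The tables list only indices below 6, in agreement with \<open>f\<close>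
    vanishing on \<open>z\<close>; the comparison thus reduces to a 5 by 5 matrix.\<close>
  have t6: "t i j = 0" if "i = 6 \<or> j = 6" for i j
  proof -
    have "(\<Sum>(k, l, c)\<leftarrow>tab. if k = i \<and> l = j then c else 0) = (\<Sum>_\<leftarrow>tab. 0)"
      using tab that by (intro arg_cong[of _ _ sum_list] map_cong) auto
    then show ?thesis
      by (simp add: t_def)
  qed
  have "{1..6} = {1, 2, 3, 4, 5, 6::nat}"
    by auto
  then have "has_products x tab \<longleftrightarrow> (\<forall>i\<in>{1, 2, 3, 4, 5, 6}. \<forall>j\<in>{1, 2, 3, 4, 5, 6}. f (x i) (x j) = t i j)"
    using z(1) unfolding has_products_def t_def[symmetric] by (simp add: f x(6))
  also have "\<dots> \<longleftrightarrow> map (\<lambda>u. map (f u) [v1, v2, v3, v4, v5]) [v1, v2, v3, v4, v5] = table_gram tab"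
    unfolding table_gram_def t_def[symmetric] by (simp add: x x(1)[unfolded One_nat_def] z t6 conj_ac)
  finally show ?thesis .
qed

text \<open>The condition concerns the indexed family rather than its image, so it gives injectivity
  as well: a repetition would be a relation with coefficients 1 and -1.\<close>

lemma is_basis6I:
  assumes d: "dim (UNIV :: 'a set) = 6"
    and ind: "\<And>c i. (\<Sum>i\<in>{1..6}. scale (c i) (x i)) = 0 \<Longrightarrow> i \<in> {1..6} \<Longrightarrow> c i = 0"
  shows "is_basis6 x"
proof -
  have inj: "inj_on x {1..6}"
  proof (rule inj_onI, rule ccontr)
    fix i j :: nat
    assume ij: "i \<in> {1..6}" "j \<in> {1..6}" "x i = x j" "i \<noteq> j"
    let ?c = "\<lambda>k. (if k = i then 1 else 0) - (if k = j then 1 else 0) :: complex"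
    have eq: "scale (?c k) (x k) = (if k = i then x k else 0) - (if k = j then x k else 0)" for k
      by (simp add: scale_left_diff_distrib)
    have "(\<Sum>k\<in>{1..6}. scale (?c k) (x k)) = x i - x j"
      unfolding eq sum_subtractf using ij by simp
    then have "?c i = 0"
      using ij by (intro ind[of ?c]) auto
    then show False
      using ij by simp
  qed
  have "independent (x ` {1..6})"
  proof (rule independent_if_scalars_zero)
    fix g y
    assume g: "(\<Sum>y\<in>x ` {1..6}. scale (g y) y) = 0" and y: "y \<in> x ` {1..6}"
    then obtain i where i: "y = x i" "i \<in> {1..6}"
      by blast
    have "(\<Sum>i\<in>{1..6}. scale (g (x i)) (x i)) = 0"
      using g unfolding sum.reindex[OF inj] by (simp add: o_def)
    then show "g y = 0"
      using ind[of "\<lambda>i. g (x i)" i] i by blast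
  qed simp
  moreover obtain X where "independent X" "UNIV \<subseteq> span X" "card X = 6"
    using basis_exists[of UNIV] d by metis
  then interpret fd: finite_dimensional_vector_space scale X
    by unfold_locales (auto intro: card_ge_0_finite)
  have "span (x ` {1..6}) = UNIV"
    using fd.card_ge_dim_independent[of "x ` {1..6}" UNIV] calculation d card_image[OF inj] by auto
  ultimately show ?thesis
    using inj by (simp add: is_basis6_def)
qed

end

text \<open>The product on coordinates is \<open>bracket\<close> carried over along a linear
  bijection, so the basis and its table can be found in the original space.\<close>

lemma transport_to_coordinates:
  fixes scale :: "complex \<Rightarrow> 'a::ab_group_add \<Rightarrow> 'a"
  assumes "leibniz_algebra scale bracket" and "vector_space.dim scale (UNIV :: 'a set) = 6"
  obtains br :: "complex^6 \<Rightarrow> complex^6 \<Rightarrow> complex^6" and \<phi> :: "'a \<Rightarrow> complex^6"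
  where "leibniz_algebra (*s) br" "leibniz_isomorphic scale bracket (*s) br"
    "\<forall>x. leibniz_algebra.is_basis6 scale x \<longrightarrow> leibniz_algebra.is_basis6 (*s) (\<phi> \<circ> x)"
    "\<forall>x tab. leibniz_algebra.has_products (*s) br (\<phi> \<circ> x) tab \<longleftrightarrow>
       leibniz_algebra.has_products scale bracket x tab"
proof -
  interpret leibniz_algebra scale bracket
    by fact
  obtain X where X: "independent X" "UNIV \<subseteq> span X" "card X = 6"
    using basis_exists[of UNIV] assms(2) by metis
  interpret fd: finite_dimensional_vector_space scale X
    using X by unfold_locales (auto intro: card_ge_0_finite)
  interpret pair: finite_dimensional_vector_space_pair scale X "(*s) :: complex \<Rightarrow> complex^6 \<Rightarrow> complex^6" cart_basis ..
  have "fd.dimension = vec.dimension TYPE(complex) TYPE(6)"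
    by (simp add: fd.dimension_def vec.dimension_def X card_cart_basis)
  then obtain \<phi> :: "'a \<Rightarrow> complex^6" where \<phi>: "Vector_Spaces.linear scale (*s) \<phi>" "bij \<phi>"
    using pair.basis_change_exists by blast
  interpret \<phi>: Vector_Spaces.linear scale "(*s)" \<phi>
    by (rule \<phi>(1))
  define \<psi> where "\<psi> = inv_into UNIV \<phi>"
  have \<phi>\<psi>: "\<psi> (\<phi> a) = a" "\<phi> (\<psi> u) = u" for a u
    using \<phi>(2) by (auto simp: \<psi>_def bij_is_inj bij_is_surj surj_f_inv_f)
  have \<psi>: "\<psi> (u + v) = \<psi> u + \<psi> v" "\<psi> (c *s u) = scale c (\<psi> u)" for u v c
    by (metis \<phi>.add \<phi>.scale \<phi>\<psi>)+
  define br where "br u v = \<phi> (bracket (\<psi> u) (\<psi> v))" for u v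
  have br: "leibniz_algebra (*s) br"
  proof unfold_locales
    show "br a (br b c) = br (br a b) c + br b (br a c)" for a b c
      by (simp add: br_def \<phi>\<psi> leibniz[of "\<psi> a"] \<phi>.add)
  qed (simp_all add: br_def \<psi> bracket_linear \<phi>.add \<phi>.scale)
  interpret L: leibniz_algebra "(*s)" br
    by (rule br)
  have "leibniz_isomorphic scale bracket (*s) br"
    unfolding leibniz_isomorphic_def using \<phi> by (auto simp: br_def \<phi>\<psi>)
  moreover have "L.is_basis6 (\<phi> \<circ> x)" if "is_basis6 x" for x
  proof -
    have \<phi>inj: "inj_on \<phi> A" for A
      using \<phi>(2) by (metis bij_is_inj inj_on_subset subset_UNIV)
    have "inj_on (\<phi> \<circ> x) {1..6}"
      using that \<phi>inj by (auto simp: is_basis6_def intro: comp_inj_on)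
    moreover have "vec.independent (\<phi> ` x ` {1..6})"
      using that \<phi>inj by (intro \<phi>.independent_injective_image) (simp_all add: is_basis6_def)
    moreover have "vec.span (\<phi> ` x ` {1..6}) = \<phi> ` UNIV"
      using that by (simp add: is_basis6_def \<phi>.span_image)
    ultimately show ?thesis
      using \<phi>(2) by (simp add: L.is_basis6_def image_comp bij_is_surj)
  qed
  moreover have "L.has_products (\<phi> \<circ> x) tab \<longleftrightarrow> has_products x tab" for x tab
    unfolding L.has_products_def has_products_def
    by (simp add: br_def \<phi>\<psi> \<phi>.scale[symmetric] inj_eq[OF bij_is_inj[OF \<phi>(2)]])
  ultimately show thesis
    using that[OF br] by blast
qed

text \<open>The pieces of this union account for the 23 families of tables: two quintic, six cubic
  plus planar, then three quartic and six pairs of planes with one square, two cubic with two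
  squares, three planar with three, and the identity.\<close>

lemma canonical_grams_5:
  "canonical_grams 5 =
    quintic_blocks \<union> {diag_sum M N |M N. M \<in> cubic_blocks \<and> N \<in> planar_blocks} \<union>
    (\<lambda>M. diag_sum M [[1]]) ` (quartic_blocks \<union> orthogonal_planes \<union>
      (\<lambda>M. diag_sum M [[1]]) ` (cubic_blocks \<union>
        (\<lambda>M. diag_sum M [[1]]) ` (planar_blocks \<union> {[[1, 0], [0, 1]]})))"
proof -
  have "canonical_grams 2 = planar_blocks \<union> {[[1, 0], [0, 1]]}"
    by (simp add: eval_nat_numeral unpeeled_blocks_def diag_sum_def)
  then have "canonical_grams 3 = cubic_blocks \<union> (\<lambda>M. diag_sum M [[1]]) ` (planar_blocks \<union> {[[1, 0], [0, 1]]})"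
    using canonical_grams.simps(2)[of 2] by (simp add: unpeeled_blocks_def)
  then have "canonical_grams 4 = quartic_blocks \<union> orthogonal_planes \<union> (\<lambda>M. diag_sum M [[1]]) ` (cubic_blocks \<union>
        (\<lambda>M. diag_sum M [[1]]) ` (planar_blocks \<union> {[[1, 0], [0, 1]]}))"
    using canonical_grams.simps(2)[of 3] by (simp add: unpeeled_blocks_def)
  then show ?thesis
    using canonical_grams.simps(2)[of 4] by (simp add: unpeeled_blocks_def)
qed

lemmas block_set_defs = quintic_blocks_def cubic_blocks_def quartic_blocks_def orthogonal_planes_def
  planar_blocks_def hyperbolic_blocks_def

lemmas block_defs = quintic_blocks_def cubic_blocks_def quartic_blocks_def quartic_block_def orthogonal_planes_def
  planar_blocks_def hyperbolic_blocks_def hyperbolic_block_def tilted_block_def diag_sum_def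

text \<open>A matrix and its transpose without common kernel vector. This is weaker than a nonzero
  determinant, which fails for the blocks having a zero row and a zero column.\<close>

definition nonsingular5 :: "complex list list \<Rightarrow> bool" where
  "nonsingular5 M \<longleftrightarrow> (\<forall>a b c d e.
    (\<forall>r\<in>set M. a * r ! 0 + b * r ! 1 + c * r ! 2 + d * r ! 3 + e * r ! 4 = 0) \<and>
    (\<forall>j\<in>{0, 1, 2, 3, 4}.
      a * M ! 0 ! j + b * M ! 1 ! j + c * M ! 2 ! j + d * M ! 3 ! j + e * M ! 4 ! j = 0) \<longrightarrow>
    a = 0 \<and> b = 0 \<and> c = 0 \<and> d = 0 \<and> e = 0)"

lemma nonsingular_canonical_gram: "M \<in> canonical_grams 5 \<Longrightarrow> nonsingular5 M"
  unfolding canonical_grams_5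
  by (elim UnE imageE CollectE exE conjE; simp only: block_defs; auto simp: block_defs)
    (simp_all add: nonsingular5_def)

lemma length_canonical_gram: "M \<in> canonical_grams 5 \<Longrightarrow> length M = 5"
  unfolding canonical_grams_5
  by (elim UnE imageE CollectE exE conjE; simp only: block_defs; auto simp: block_defs)

theorem theorem2p5:
  fixes scale :: "complex \<Rightarrow> 'a::ab_group_add \<Rightarrow> 'a"
    and bracket :: "'a \<Rightarrow> 'a \<Rightarrow> 'a"
  assumes "leibniz_algebra scale bracket"
    and "\<not> leibniz_algebra.is_split scale bracket"
    and "leibniz_algebra.Leib scale bracket \<noteq> {0}"
    and "leibniz_algebra.is_nilpotent scale bracket"
    and "vector_space.dim scale (UNIV :: 'a set) = 6"
    and "vector_space.dim scale (leibniz_algebra.lower_central scale bracket 2) = 1"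
  shows "\<exists>(br :: complex^6 \<Rightarrow> complex^6 \<Rightarrow> complex^6) (x :: nat \<Rightarrow> complex^6).
      leibniz_algebra (*s) br \<and>
      leibniz_isomorphic scale bracket (*s) br \<and>
      leibniz_algebra.is_basis6 (*s) x \<and>
       (leibniz_algebra.has_products (*s) br x [(1,4,1), (2,5,1), (4,2,1), (5,3,1)] \<or>
        leibniz_algebra.has_products (*s) br x [(1,5,1), (2,4,1), (2,5,1), (3,3,1), (3,4,1), (4,2,1), (4,3,-1), (5,1,1), (5,2,-1)] \<or>
        (\<exists>c. c \<notin> {1, -1} \<and>
           leibniz_algebra.has_products (*s) br x [(1,4,1), (2,3,1), (2,4,c), (3,2,c), (4,1,c), (4,2,1), (5,5,1)]) \<or>
        leibniz_algebra.has_products (*s) br x [(1,4,1), (2,3,1), (2,4,1), (3,2,1), (4,1,1), (4,2,-1), (5,5,1)] \<or>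
        leibniz_algebra.has_products (*s) br x [(1,4,1), (2,3,1), (2,4,1), (3,2,-1), (3,3,1), (4,1,-1), (4,2,1), (5,5,1)] \<or>
        leibniz_algebra.has_products (*s) br x [(1,3,1), (3,2,1), (4,5,1), (5,4,-1)] \<or>
        leibniz_algebra.has_products (*s) br x [(1,3,1), (3,2,1), (4,5,1), (5,4,-1), (5,5,1)] \<or>
        (\<exists>c. c \<notin> {1, -1} \<and>
           leibniz_algebra.has_products (*s) br x [(1,3,1), (3,2,1), (4,5,1), (5,4,c)]) \<or>
        leibniz_algebra.has_products (*s) br x [(1,3,1), (2,2,1), (2,3,1), (3,1,1), (3,2,-1), (4,5,1), (5,4,-1)] \<or>
        leibniz_algebra.has_products (*s) br x [(1,3,1), (2,2,1), (2,3,1), (3,1,1), (3,2,-1), (4,5,1), (5,4,-1), (5,5,1)] \<or>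
        (\<exists>c. c \<notin> {1, -1} \<and>
           leibniz_algebra.has_products (*s) br x [(1,3,1), (2,2,1), (2,3,1), (3,1,1), (3,2,-1), (4,5,1), (5,4,c)]) \<or>
        leibniz_algebra.has_products (*s) br x [(1,3,1), (3,2,1), (4,4,1), (5,5,1)] \<or>
        leibniz_algebra.has_products (*s) br x [(1,3,1), (2,2,1), (2,3,1), (3,1,1), (3,2,-1), (4,4,1), (5,5,1)] \<or>
        leibniz_algebra.has_products (*s) br x [(1,2,1), (2,1,-1), (3,4,1), (4,3,-1), (5,5,1)] \<or>
        leibniz_algebra.has_products (*s) br x [(1,2,1), (2,1,-1), (3,4,1), (4,3,-1), (4,4,1), (5,5,1)] \<or>
        (\<exists>c. c \<notin> {1, -1} \<and>
           leibniz_algebra.has_products (*s) br x [(1,2,1), (2,1,-1), (3,4,1), (4,3,c), (5,5,1)]) \<or>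
        leibniz_algebra.has_products (*s) br x [(1,2,1), (2,1,-1), (2,2,1), (3,4,1), (4,3,-1), (4,4,1), (5,5,1)] \<or>
        (\<exists>c. c \<notin> {1, -1} \<and>
           leibniz_algebra.has_products (*s) br x [(1,2,1), (2,1,-1), (2,2,1), (3,4,1), (4,3,c), (5,5,1)]) \<or>
        (\<exists>c1 c2. c1 \<notin> {1, -1} \<and> c2 \<notin> {1, -1} \<and>
           leibniz_algebra.has_products (*s) br x [(1,2,1), (2,1,c1), (3,4,1), (4,3,c2), (5,5,1)]) \<or>
        leibniz_algebra.has_products (*s) br x [(1,2,1), (2,1,-1), (3,3,1), (4,4,1), (5,5,1)] \<or>
        leibniz_algebra.has_products (*s) br x [(1,2,1), (2,1,-1), (2,2,1), (3,3,1), (4,4,1), (5,5,1)] \<or>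
        (\<exists>c. c \<notin> {1, -1} \<and>
           leibniz_algebra.has_products (*s) br x [(1,2,1), (2,1,c), (3,3,1), (4,4,1), (5,5,1)]) \<or>
        leibniz_algebra.has_products (*s) br x [(1,1,1), (2,2,1), (3,3,1), (4,4,1), (5,5,1)])"
proof -
  interpret leibniz_algebra scale bracket
    by fact
  obtain z where z: "z \<noteq> 0" "lower_central 2 = span {z}" "\<forall>a b. bracket a b \<in> span {z}"
    using derived_generator assms(6) by blast
  note zz = derived_central[OF assms(4) z]
  \<comment> \<open>Since \<open>z\<close> is nonzero the coefficient is unique, which
    \<open>f_eqI\<close> records and from which bilinearity follows.\<close>
  define f where "f a b = (SOME c. bracket a b = scale c z)" for a b
  have f: "bracket a b = scale (f a b) z" for a b
    unfolding f_def using z(3) by (intro someI_ex[of "\<lambda>c. bracket a b = scale c z"]) (auto simp: span_singleton)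
  have f_eqI: "f a b = c" if "bracket a b = scale c z" for a b c
    using that z(1) by (simp add: f)
  have fz: "f a z = 0" "f z a = 0" for a
    using zz by (auto intro: f_eqI)
  obtain X where X: "independent X" "UNIV \<subseteq> span X" "card X = 6"
    using basis_exists[of UNIV] assms(5) by metis
  interpret bilinear_form scale X f
  proof unfold_locales
    show "finite X" "independent X" "span X = UNIV"
      using X by (auto intro: card_ge_0_finite)
    show "f (a + b) c = f a c + f b c" "f c (a + b) = f c a + f c b" for a b c
      by (rule f_eqI; simp only: bracket_linear scale_left_distrib flip: f)+
    show "f (scale k a) b = k * f a b" "f a (scale k b) = k * f a b" for k a b
      by (rule f_eqI; simp only: bracket_linear flip: f scale_scale)+
  qed
  have "independent {z}"
    using z(1) by simp
  then obtain Y where Y: "{z} \<subseteq> Y" "independent Y" "UNIV \<subseteq> span Y"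
    by (rule maximal_independent_subset_extend[OF subset_UNIV])
  \<comment> \<open>Any complement of \<open>z\<close> serves: \<open>f\<close> ignores multiples of
    \<open>z\<close>, so a vector radical for \<open>f\<close> on \<open>U\<close> annihilates the
    whole algebra.\<close>
  define U where "U = span (Y - {z})"
  have dec: "\<exists>k. a - scale k z \<in> U" for a
  proof -
    have "a \<in> span (insert z (Y - {z}))"
      using Y(1,3) by (auto simp: insert_absorb)
    then show ?thesis
      unfolding span_breakdown_eq U_def .
  qed
  have zU: "z \<notin> U"
    using Y(1,2) unfolding U_def dependent_def by blast
  have U: "subspace U"
    by (simp add: U_def)
  have "card Y = 6"
    using dim_eq_card[of Y UNIV] Y assms(5) by auto
  moreover have "independent (Y - {z})"
    using Y(2) by (rule independent_mono) blast
  ultimately have dimU: "dim U = 5"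
    using Y(1) finiteI_independent[OF Y(2)] by (simp add: U_def dim_eq_card_independent)
  have "nondegenerate U"
    unfolding nondegenerate_def
  proof (intro ballI impI)
    fix r assume r: "r \<in> U" "\<forall>u\<in>U. f r u = 0 \<and> f u r = 0"
    have "bracket r a = 0 \<and> bracket a r = 0" for a
    proof -
      obtain k where "a - scale k z \<in> U"
        using dec by blast
      then have "f r (a - scale k z) = 0" "f (a - scale k z) r = 0"
        using r(2) by auto
      then show ?thesis
        by (simp add: f bilinear fz)
    qed
    then have "r \<in> span {z}"
      using center_non_split[OF assms(2) z(1,3)] by blast
    then obtain k where k: "r = scale k z"
      unfolding span_singleton by auto
    have "k = 0"
    proof (rule ccontr)
      assume "k \<noteq> 0"
      then have "z = scale (1 / k) r"
        by (simp add: k)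
      then show False
        using zU r(1) U subspace_scale by metis
    qed
    then show "r = 0"
      by (simp add: k)
  qed
  then obtain vs where vs: "gram vs \<in> canonical_grams 5"
    using classification[OF U] dimU by (auto simp: realizes_some_def realizes_def)
  have "length vs = 5"
    using length_canonical_gram[OF vs] by simp
  then obtain v1 v2 v3 v4 v5 where v: "vs = [v1, v2, v3, v4, v5]"
    by (auto simp: length_Suc_conv eval_nat_numeral)
  \<comment> \<open>Entry 0 is a dummy, as the tables count from 1.\<close>
  define x where "x n = [z, v1, v2, v3, v4, v5, z] ! n" for n
  have x: "x 1 = v1" "x 2 = v2" "x 3 = v3" "x 4 = v4" "x 5 = v5" "x 6 = z"
    by (simp_all add: x_def)
  have basis: "is_basis6 x"
  proof (rule is_basis6I[OF assms(5)])
    fix c :: "nat \<Rightarrow> complex" and i :: nat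
    assume c: "(\<Sum>i\<in>{1..6}. scale (c i) (x i)) = 0" and i: "i \<in> {1..6}"
    have set6: "{1..6} = {1, 2, 3, 4, 5, 6::nat}"
      by auto
    have comb: "scale (c 1) v1 + scale (c 2) v2 + scale (c 3) v3 + scale (c 4) v4 + scale (c 5) v5
        + scale (c 6) z = 0"
      using c unfolding set6 by (simp add: x x(1)[unfolded One_nat_def] add.assoc)
    \<comment> \<open>Pairing the relation with any \<open>v\<close> on either side kills
      \<open>z\<close>; taking \<open>v\<close> among the five vectors gives the premises of
      \<open>nonsingular5\<close>.\<close>
    have row: "c 1 * f v v1 + c 2 * f v v2 + c 3 * f v v3 + c 4 * f v v4 + c 5 * f v v5 = 0" for v
      using arg_cong[OF comb, of "f v"] by (simp add: bilinear fz)
    have column: "c 1 * f v1 v + c 2 * f v2 v + c 3 * f v3 v + c 4 * f v4 v + c 5 * f v5 v = 0" for v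
      using arg_cong[OF comb, of "\<lambda>u. f u v"] by (simp add: bilinear fz)
    have "c 1 = 0" "c 2 = 0" "c 3 = 0" "c 4 = 0" "c 5 = 0"
      using nonsingular_canonical_gram[OF vs, unfolded nonsingular5_def,
          rule_format, of "c 1" "c 2" "c 3" "c 4" "c 5"] row column
      by (auto simp: gram_def v)
    moreover from this have "c 6 = 0"
      using comb z(1) by simp
    moreover have "i = 1 \<or> i = 2 \<or> i = 3 \<or> i = 4 \<or> i = 5 \<or> i = 6"
      using i by auto
    ultimately show "c i = 0"
      by metis
  qed
  obtain br :: "complex^6 \<Rightarrow> complex^6 \<Rightarrow> complex^6" and \<phi>
    where br: "leibniz_algebra (*s) br" "leibniz_isomorphic scale bracket (*s) br"
      and \<phi>: "\<forall>x. is_basis6 x \<longrightarrow> leibniz_algebra.is_basis6 (*s) (\<phi> \<circ> x)"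
        "\<forall>x tab. leibniz_algebra.has_products (*s) br (\<phi> \<circ> x) tab \<longleftrightarrow> has_products x tab"
    by (rule transport_to_coordinates[OF assms(1,5)])
  have products: "leibniz_algebra.has_products (*s) br (\<phi> \<circ> x) tab \<longleftrightarrow> gram vs = table_gram tab"
    if "\<forall>(k, l, c)\<in>set tab. k < 6 \<and> l < 6" for tab
    using \<phi>(2) has_products_iff_gram[OF f z(1) fz x that] by (simp add: gram_def v)
  show ?thesis
  proof (rule exI[of _ br], rule exI[of _ "\<phi> \<circ> x"], intro conjI br)
    show "leibniz_algebra.is_basis6 (*s) (\<phi> \<circ> x)"
      using \<phi>(1) basis by blast
  \<comment> \<open>Splitting the union into single matrices leaves one table to match each time;
    the block parameters become the existential witnesses.\<close>
  qed (simp add: products table_gram_def, use vs[unfolded canonical_grams_5 block_set_defs] in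
    \<open>elim UnE imageE CollectE exE conjE insertE emptyE; simp add: block_defs\<close>)
qed

end
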